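(* Let $a=\frac pq\in(0,\frac12)$ be rational ($p,q$ positive integers), $b\in(0,\frac12)$, and let $\theta$ be a non-exceptional direction for the billiard in the square table with one-sided mirror $I=\{a\}\times[0,b]$. Then the interval translation map $S$ defined in the context (equivalently, the billiard in direction $\theta$) has at most $q$ minimal components, and on each minimal component the number of ergodic invariant measures for the interval translation map/billiard is at most $1+2q$.
   Context: Billiard: the table is the square $[0,\frac12]\times[0,\frac12]$ with a vertical wall $I=\{a\}\times[0,b]$. A point particle moves at unit speed along straight lines; at the boundary of the square it is reflected by the usual law. If it arrives at $I$ from the left it passes through unperturbed; if it arrives at $I$ from the right it is reflected by the usual law. A direction $\theta$ is exceptional if there is a billiard orbit in direction $\theta$ from an end point of $I$ to an end point of $I$ (vertical directions are exceptional); otherwise it is non-exceptional. The billiard unfolds to a linear flow on the unit torus $\mathbb R^2/\mathbb Z^2$ with slits $\{a\}\times[-b,b]$ and $\{1-a\}\times[-b,b]$, where a trajectory reaching the reflecting copy jumps from the slit at $x=1-a$ to the slit at $x=a$. The return map $S$ to the union of vertical sections $x=\frac kq$, $k\in\{0,1,\dots,q-1\}$ (the section $x=\frac kq$ being $\{k\}\times\mathbb R/\mathbb Z$) is $$S(i,y)=\begin{cases}(p,\ y+\tan\theta/q \bmod 1)&\text{if } i=q-p \text{ and } y\in[-b,b],\\ (i+1 \bmod q,\ y+\tan\theta/q \bmod 1)&\text{otherwise.}\end{cases}$$ A minimal component is an $\omega$-limit set of $S$ in which every orbit is dense. Invariant measures are Borel probability measures. *)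

theory Defs
  imports "HOL-Probability.Probability_Measure"
begin

section \<open>The billiard with a one-sided mirror\<close>

definition table :: "(real \<times> real) set" where
  "table = {0..1/2} \<times> {0..1/2}"

definition mirror :: "real \<Rightarrow> real \<Rightarrow> (real \<times> real) set" where
  "mirror a b = {a} \<times> {0..b}"

text \<open>Velocity after arriving at \<open>P\<close> with velocity \<open>v\<close>. At a corner of the square both components
  are reversed, which is what the unfolding to the torus prescribes; away from the walls the
  velocity is unchanged.\<close>

definition reflect :: "real \<Rightarrow> real \<Rightarrow> real \<times> real \<Rightarrow> real \<times> real \<Rightarrow> real \<times> real" where
  "reflect a b P v =
     (if (fst P = 0 \<and> fst v < 0) \<or> (fst P = 1/2 \<and> fst v > 0) \<or> (P \<in> mirror a b \<and> fst v < 0)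
        then - fst v else fst v,
      if (snd P = 0 \<and> snd v < 0) \<or> (snd P = 1/2 \<and> snd v > 0)
        then - snd v else snd v)"

text \<open>A straight flight of positive duration which stays in the table and does not meet the mirror
  from the right before its end, followed by the reflection (if any) at its end point. A flight
  may start on the mirror with leftward velocity; since arriving leftward at the mirror always
  reverses the velocity, this occurs only for initial states.\<close>

definition billiard_step ::
  "real \<Rightarrow> real \<Rightarrow> (real \<times> real) \<times> (real \<times> real) \<Rightarrow> (real \<times> real) \<times> (real \<times> real) \<Rightarrow> bool" where
  "billiard_step a b = (\<lambda>(P, v) (P', v'). \<exists>s>0.
      P' = P + s *\<^sub>R v \<and>
      (\<forall>r\<in>{0..s}. P + r *\<^sub>R v \<in> table) \<and>
      (\<forall>r\<in>{0<..<s}. \<not> (P + r *\<^sub>R v \<in> mirror a b \<and> fst v < 0)) \<and>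
      v' = reflect a b P' v)"

text \<open>An orbit in direction \<open>\<theta>\<close> only has the velocities \<open>(\<plusminus>cos \<theta>, \<plusminus>sin \<theta>)\<close>, which are identified by the
  unfolding; it may leave the end point of the mirror with any of them.\<close>

definition directions :: "real \<Rightarrow> (real \<times> real) set" where
  "directions \<theta> = {cos \<theta>, - cos \<theta>} \<times> {sin \<theta>, - sin \<theta>}"

definition exceptional :: "real \<Rightarrow> real \<Rightarrow> real \<Rightarrow> bool" where
  "exceptional a b \<theta> \<longleftrightarrow>
     cos \<theta> = 0 \<or>
     (\<exists>P\<in>{(a, 0), (a, b)}. \<exists>Q\<in>{(a, 0), (a, b)}. \<exists>v\<in>directions \<theta>. \<exists>w.
        (billiard_step a b)\<^sup>+\<^sup>+ (P, v) (Q, w))"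

section \<open>The circle of real numbers modulo one\<close>

quotient_type circle = real / "\<lambda>x y. x - y \<in> \<int>" morphisms rep_circle to_circle
proof (rule equivpI)
  show "reflp (\<lambda>x y :: real. x - y \<in> \<int>)" by (simp add: reflp_def)
  show "symp (\<lambda>x y :: real. x - y \<in> \<int>)"
  proof (rule sympI)
    fix x y :: real
    assume "x - y \<in> \<int>"
    then have "- (x - y) \<in> \<int>" by (rule Ints_minus)
    then show "y - x \<in> \<int>" by simp
  qed
  show "transp (\<lambda>x y :: real. x - y \<in> \<int>)"
  proof (rule transpI)
    fix x y z :: real
    assume "x - y \<in> \<int>" "y - z \<in> \<int>"
    then have "(x - y) + (y - z) \<in> \<int>" by (rule Ints_add)
    then show "x - z \<in> \<int>" by simp
  qed
qed

lift_definition rotate :: "real \<Rightarrow> circle \<Rightarrow> circle" is "\<lambda>s y. y + s"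
  by simp

lemma dist_round_int_shift:
  fixes x y :: real
  assumes "x - y \<in> \<int>"
  shows "\<bar>x - of_int (round x)\<bar> = \<bar>y - of_int (round y)\<bar>"
proof -
  obtain k where "x - y = of_int k" using assms by (rule Ints_cases)
  then have k: "x = y + of_int k" by simp
  have "\<lfloor>(y + 1/2) + of_int k\<rfloor> = \<lfloor>y + 1/2\<rfloor> + k" by (rule floor_add_int[symmetric])
  then have "round x = round y + k" unfolding k round_def by (simp add: ac_simps)
  then show ?thesis using k by simp
qed

text \<open>The quotient metric: the distance of two classes is the distance of \<open>x - y\<close> to the nearest
  integer.\<close>

instantiation circle :: metric_space
begin

lift_definition dist_circle :: "circle \<Rightarrow> circle \<Rightarrow> real"
  is "\<lambda>x y. \<bar>(x - y) - of_int (round (x - y))\<bar>"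
proof -
  fix x x' y y' :: real
  assume "x - x' \<in> \<int>" "y - y' \<in> \<int>"
  then have "(x - x') - (y - y') \<in> \<int>" by (rule Ints_diff)
  then have "(x - y) - (x' - y') \<in> \<int>" by (simp add: algebra_simps)
  then show "\<bar>(x - y) - of_int (round (x - y))\<bar> = \<bar>(x' - y') - of_int (round (x' - y'))\<bar>"
    by (rule dist_round_int_shift)
qed

definition uniformity_circle :: "(circle \<times> circle) filter" where
  "uniformity_circle = (INF e\<in>{0<..}. principal {(x, y). dist x y < e})"

definition open_circle :: "circle set \<Rightarrow> bool" where
  "open_circle U \<longleftrightarrow> (\<forall>x\<in>U. eventually (\<lambda>(x', y). x' = x \<longrightarrow> y \<in> U) uniformity)"

instance
proof
  show "uniformity = (INF e\<in>{0<..}. principal {(x :: circle, y). dist x y < e})"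
    by (rule uniformity_circle_def)
next
  fix U :: "circle set"
  show "open U \<longleftrightarrow> (\<forall>x\<in>U. eventually (\<lambda>(x', y). x' = x \<longrightarrow> y \<in> U) uniformity)"
    by (rule open_circle_def)
next
  fix x y :: circle
  show "dist x y = 0 \<longleftrightarrow> x = y"
  proof (transfer, rule iffI)
    fix x y :: real
    assume "\<bar>(x - y) - of_int (round (x - y))\<bar> = 0"
    then have "x - y = of_int (round (x - y))" by simp
    then show "x - y \<in> \<int>" by (metis Ints_of_int)
  next
    fix x y :: real
    assume "x - y \<in> \<int>"
    then show "\<bar>(x - y) - of_int (round (x - y))\<bar> = 0" by (auto elim!: Ints_cases)
  qed
next
  fix x y z :: circle
  show "dist x y \<le> dist x z + dist y z"
  proof transfer
    fix x y z :: real
    have "\<bar>(x - y) - of_int (round (x - y))\<bar>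
        \<le> \<bar>(x - y) - of_int (round (x - z) - round (y - z))\<bar>"
      by (rule round_diff_minimal)
    then show "\<bar>(x - y) - of_int (round (x - y))\<bar>
        \<le> \<bar>(x - z) - of_int (round (x - z))\<bar> + \<bar>(y - z) - of_int (round (y - z))\<bar>"
      by simp
  qed
qed

end

section \<open>The interval translation map\<close>

text \<open>The pair \<open>(i, y)\<close> is the point \<open>y\<close> of the section \<open>x = i/q\<close>; only \<open>i < q\<close> matters.\<close>

definition sections :: "nat \<Rightarrow> (nat \<times> circle) set" where
  "sections q = {..<q} \<times> UNIV"

definition itm :: "nat \<Rightarrow> nat \<Rightarrow> real \<Rightarrow> real \<Rightarrow> nat \<times> circle \<Rightarrow> nat \<times> circle" where
  "itm p q b \<theta> = (\<lambda>(i, y).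
     (if i = q - p \<and> y \<in> to_circle ` {- b..b} then p else (i + 1) mod q,
      rotate (tan \<theta> / real q) y))"

section \<open>Minimal components and ergodic measures\<close>

definition orbit :: "('a \<Rightarrow> 'a) \<Rightarrow> 'a \<Rightarrow> 'a set" where
  "orbit f x = {(f ^^ n) x | n. True}"

definition omega_limit :: "('a::topological_space \<Rightarrow> 'a) \<Rightarrow> 'a \<Rightarrow> 'a set" where
  "omega_limit f x = (\<Inter>N. closure {(f ^^ n) x | n. n \<ge> N})"

text \<open>As \<open>f\<close> is discontinuous, an \<open>\<omega>\<close>-limit set may contain points whose orbits leave it, namely points
  eventually mapped to a discontinuity that is approached from the other side. The orbits in
  \<open>C\<close> are those contained in \<open>C\<close>; demanding density of the others too would only give fewer minimal
  components.\<close>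

definition minimal_component ::
  "'a set \<Rightarrow> ('a::topological_space \<Rightarrow> 'a) \<Rightarrow> 'a set \<Rightarrow> bool" where
  "minimal_component X f C \<longleftrightarrow>
     (\<exists>x\<in>X. C = omega_limit f x) \<and>
     (\<forall>z. orbit f z \<subseteq> C \<longrightarrow> C \<subseteq> closure (orbit f z))"

definition invariant_measure_on ::
  "('a::topological_space \<Rightarrow> 'a) \<Rightarrow> 'a set \<Rightarrow> 'a measure \<Rightarrow> bool" where
  "invariant_measure_on f C M \<longleftrightarrow>
     prob_space M \<and> sets M = sets borel \<and> emeasure M C = 1 \<and>
     (\<forall>A\<in>sets borel. emeasure M (f -` A) = emeasure M A)"

definition ergodic_measure_on ::
  "('a::topological_space \<Rightarrow> 'a) \<Rightarrow> 'a set \<Rightarrow> 'a measure \<Rightarrow> bool" where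
  "ergodic_measure_on f C M \<longleftrightarrow>
     invariant_measure_on f C M \<and>
     (\<forall>A\<in>sets borel. f -` A = A \<longrightarrow> emeasure M A = 0 \<or> emeasure M A = 1)"

end

theory Submission
  imports Defs "HOL-Analysis.Kronecker_Approximation_Theorem"
begin

text \<open>If \<open>tan \<theta>\<close> were rational, the return map to the line \<open>x = 1 - a\<close> of the unfolded billiard
  would have a periodic orbit. Pushing that orbit upwards until it first meets an end point of the
  mirror gives a billiard orbit between end points, so non-exceptional directions have irrational
  slope. This irrationality suffices, because \<open>S\<close> is then a skew product over an irrational
  rotation whose fibres have \<open>q\<close> points. Every \<open>\<omega>\<close>-limit set meets every fibre, and two minimal
  components with a common point in a fibre that avoids all discontinuities coincide; this gives at
  most \<open>q\<close> components. All invariant measures project to the same measure of the circle, and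
  distinct ergodic measures live on disjoint sets, each meeting almost every fibre; this gives at
  most \<open>q \<le> 1 + 2 * q\<close> ergodic measures.\<close>

section \<open>Unfolding the billiard\<close>

definition tri :: "real \<Rightarrow> real" where
  "tri x = min (frac x) (1 - frac x)"

definition dir :: "real \<Rightarrow> real" where
  "dir x = (if frac x < 1/2 then 1 else -1)"

text \<open>In each coordinate, the half \<open>[0, 1/2)\<close> of the torus carries the motion in positive direction and
  \<open>[1/2, 1)\<close> the motion in negative direction; the half-open choice makes a point over a wall the
  state after the reflection.\<close>

definition unfolded :: "real \<Rightarrow> real \<Rightarrow> real \<Rightarrow> real \<Rightarrow> (real \<times> real) \<times> (real \<times> real)" where
  "unfolded c s x y = ((tri x, tri y), (c * dir x, s * dir y))"

lemma tri_bounds: "0 \<le> tri x" "tri x \<le> 1/2"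
  using frac_lt_1[of x] by (auto simp: tri_def min_def intro: less_imp_le)

lemma unfolded_add_1: "unfolded c s (x + 1) y = unfolded c s x y"
  by (simp add: unfolded_def tri_def dir_def frac_1_eq)

lemma frac_eqI: "x = of_int k + f \<Longrightarrow> 0 \<le> f \<Longrightarrow> f < 1 \<Longrightarrow> frac x = f"
  for x :: real
  by (simp add: frac_unique_iff)

lemma half_cell_cases:
  assumes "x \<le> u" "2 * u \<le> of_int \<lfloor>2 * x\<rfloor> + 1"
  obtains (right) "dir x = 1" "frac u = frac x + (u - x)" "frac x < 1/2" "frac u \<le> 1/2"
  | (left) "dir x = -1" "frac u = frac x + (u - x)" "frac x \<ge> 1/2"
  | (wrap) "dir x = -1" "frac u = 0" "frac x + (u - x) = 1" "frac x \<ge> 1/2"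
proof -
  define m where "m = \<lfloor>x\<rfloor>"
  have x: "x = of_int m + frac x" by (simp add: m_def frac_def)
  have f: "0 \<le> frac x" "frac x < 1" by (simp_all add: frac_lt_1)
  show thesis
  proof (cases "frac x < 1/2")
    case True
    then have "\<lfloor>2 * x\<rfloor> = 2 * m" using x f by linarith
    then have "u \<le> m + 1/2" using assms by linarith
    then have "frac u = frac x + (u - x)" using assms x f by (intro frac_eqI[of u m]) linarith+
    moreover have "frac x + (u - x) \<le> 1/2" using \<open>u \<le> m + 1/2\<close> x by linarith
    ultimately show thesis using True by (intro right) (auto simp: dir_def)
  next
    case False
    then have "\<lfloor>2 * x\<rfloor> = 2 * m + 1" using x f by linarith
    then have u: "u \<le> m + 1" using assms by linarith
    show thesis
    proof (cases "u = m + 1")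
      case True
      then have "u = of_int (m + 1)" by simp
      then have "frac u = 0" by (metis frac_of_int)
      then show thesis using True x False by (intro wrap) (auto simp: dir_def)
    next
      case ne: False
      then have "frac u = frac x + (u - x)" using assms x f u by (intro frac_eqI[of u m]) linarith+
      then show thesis using False by (intro left) (auto simp: dir_def)
    qed
  qed
qed

lemma tri_half_cell:
  assumes "x \<le> u" "2 * u \<le> of_int \<lfloor>2 * x\<rfloor> + 1"
  shows "tri u = tri x + dir x * (u - x)"
  using assms by (cases rule: half_cell_cases[OF assms]) (auto simp: tri_def min_def simp del: frac_eq_0_iff)

lemma reflect_half_cell:
  assumes "x \<le> u" "2 * u \<le> of_int \<lfloor>2 * x\<rfloor> + 1" "0 \<le> c" "c = 0 \<or> x < u"
  shows "(if (tri u = 0 \<and> c * dir x < 0) \<or> (tri u = 1/2 \<and> c * dir x > 0)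
            then - (c * dir x) else c * dir x) = c * dir u"
proof (cases "c = 0")
  case False
  then have *: "c > 0" "x < u" using assms by auto
  show ?thesis
    using * frac_lt_1[of u]
    by (cases rule: half_cell_cases[OF assms(1,2)])
      (auto simp: tri_def dir_def min_def mult_less_0_iff zero_less_mult_iff simp del: frac_eq_0_iff)
qed simp

lemma frac_half_cell:
  assumes "x \<le> u" "2 * u \<le> of_int \<lfloor>2 * x\<rfloor> + 1" "dir x < 0" "tri u = a" "0 < a" "a < 1/2"
  shows "frac u = 1 - a"
  using assms by (cases rule: half_cell_cases[OF assms(1,2)])
    (auto simp: tri_def min_def simp del: frac_eq_0_iff split: if_splits)

lemma frac_mirror_state:
  assumes "frac x = 1 - a" "0 < a" "a < 1/2"
  shows "tri x = a" "dir x = -1"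
  using assms by (auto simp: tri_def dir_def min_def)

lemma frac_left_state:
  assumes "0 < a" "a < 1/2"
  shows "tri a = a" "dir a = 1"
proof -
  have "frac a = a" using assms by (simp add: frac_eq)
  then show "tri a = a" "dir a = 1" using assms by (auto simp: tri_def dir_def min_def)
qed

text \<open>The reflecting side of the mirror lies over \<open>x = 1 - a\<close> modulo one; a reflection there is a jump
  to \<open>x = a\<close>.\<close>

definition arrival :: "real \<Rightarrow> real \<Rightarrow> real \<Rightarrow> real \<Rightarrow> real \<Rightarrow> real \<Rightarrow> (real \<times> real) \<times> (real \<times> real)" where
  "arrival a b c s x y =
     (if frac x = 1 - a \<and> tri y \<le> b then unfolded c s a y else unfolded c s x y)"

lemma billiard_step_half_cell:
  assumes a: "0 < a" "a < 1/2" and cs: "0 < c" "0 \<le> s" and t: "0 < t"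
    and x: "2 * (x + c * t) \<le> of_int \<lfloor>2 * x\<rfloor> + 1"
    and y: "2 * (y + s * t) \<le> of_int \<lfloor>2 * y\<rfloor> + 1"
    and free: "\<And>r. 0 < r \<Longrightarrow> r < t \<Longrightarrow> frac (x + c * r) \<noteq> 1 - a"
  shows "billiard_step a b (unfolded c s x y) (arrival a b c s (x + c * t) (y + s * t))"
proof -
  have le: "2 * (x + c * r) \<le> of_int \<lfloor>2 * x\<rfloor> + 1" "2 * (y + s * r) \<le> of_int \<lfloor>2 * y\<rfloor> + 1"
    "x \<le> x + c * r" "y \<le> y + s * r"
    if "0 \<le> r" "r \<le> t" for r
  proof -
    have "c * r \<le> c * t" "s * r \<le> s * t" using that cs by (auto intro: mult_left_mono)
    then show "2 * (x + c * r) \<le> of_int \<lfloor>2 * x\<rfloor> + 1" "2 * (y + s * r) \<le> of_int \<lfloor>2 * y\<rfloor> + 1"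
      using x y by (simp_all only: distrib_left)
  qed (use that cs in auto)
  have pos: "(tri x, tri y) + r *\<^sub>R (c * dir x, s * dir y) = (tri (x + c * r), tri (y + s * r))"
    if "0 \<le> r" "r \<le> t" for r
    using tri_half_cell[OF le(3) le(1), of r] tri_half_cell[OF le(4) le(2), of r] that by auto
  have x_lt: "x < x + c * t" using cs t by simp
  have y_lt: "s = 0 \<or> y < y + s * t" using cs t by (cases "s = 0") auto
  note le_t = le[OF less_imp_le[OF t] order_refl]
  note rx = reflect_half_cell[OF le_t(3,1) less_imp_le[OF cs(1)] disjI2[OF x_lt]]
    and ry = reflect_half_cell[OF le_t(4,2) cs(2) y_lt]
  have dirs: "c * dir x < 0 \<longleftrightarrow> dir x < 0" using cs by (simp add: mult_less_0_iff)
  define M where "M \<longleftrightarrow> (tri (x + c * t), tri (y + s * t)) \<in> mirror a b \<and> c * dir x < 0"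
  have M: "M \<longleftrightarrow> frac (x + c * t) = 1 - a \<and> tri (y + s * t) \<le> b"
  proof
    assume M
    then show "frac (x + c * t) = 1 - a \<and> tri (y + s * t) \<le> b"
      using frac_half_cell[OF le(3) le(1), of t a] t a by (auto simp: M_def mirror_def dirs)
  next
    assume A: "frac (x + c * t) = 1 - a \<and> tri (y + s * t) \<le> b"
    moreover have "dir x < 0"
      using A a by (cases rule: half_cell_cases[OF le_t(3,1)]) auto
    ultimately show M using frac_mirror_state[of "x + c * t" a] a tri_bounds[of "y + s * t"]
      by (auto simp: M_def mirror_def dirs)
  qed
  define v where "v = (c * dir x, s * dir y)"
  have end_eq: "arrival a b c s (x + c * t) (y + s * t)
      = ((tri (x + c * t), tri (y + s * t)), reflect a b (tri (x + c * t), tri (y + s * t)) v)"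
  proof (cases M)
    case True
    then have tr: "tri (x + c * t) = a" "dir (x + c * t) = -1"
      using M frac_mirror_state[of "x + c * t" a] a by auto
    have "dir x = -1" using True cs by (auto simp: M_def dir_def split: if_splits)
    then show ?thesis using True M ry y_lt t cs tr a frac_left_state[OF a]
      by (auto simp: arrival_def unfolded_def reflect_def M_def v_def)
  next
    case False
    then have "((tri (x + c * t), tri (y + s * t)) \<in> mirror a b \<and> c * dir x < 0) = False"
      by (simp add: M_def)
    then have "reflect a b (tri (x + c * t), tri (y + s * t)) v = (c * dir (x + c * t), s * dir (y + s * t))"
      by (simp only: reflect_def v_def fst_conv snd_conv simp_thms rx ry)
    moreover have "(frac (x + c * t) = 1 - a \<and> tri (y + s * t) \<le> b) = False" using False M by simp
    ultimately show ?thesis by (simp only: arrival_def unfolded_def if_False)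
  qed
  have "(tri x, tri y) + r *\<^sub>R v \<in> table" if "r \<in> {0..t}" for r
    using pos[of r] that tri_bounds[of "x + c * r"] tri_bounds[of "y + s * r"]
    unfolding v_def table_def by (simp del: scaleR_Pair)
  moreover have "\<not> ((tri x, tri y) + r *\<^sub>R v \<in> mirror a b \<and> fst v < 0)" if "r \<in> {0<..<t}" for r
  proof
    assume "(tri x, tri y) + r *\<^sub>R v \<in> mirror a b \<and> fst v < 0"
    then have "tri (x + c * r) = a" "dir x < 0"
      using pos[of r] that unfolding v_def by (auto simp: mirror_def dirs simp del: scaleR_Pair add_Pair)
    then have "frac (x + c * r) = 1 - a"
      using frac_half_cell[OF le(3) le(1), of r a] a that by auto
    then show False using free[of r] that by auto
  qed
  ultimately show ?thesis
    unfolding billiard_step_def end_eq using t pos[of t]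
    by (simp add: unfolded_def v_def del: scaleR_Pair add_Pair) (auto intro!: exI[of _ t] simp del: scaleR_Pair add_Pair)
qed

lemma next_wall:
  fixes x c :: real
  assumes "0 < c"
  obtains t where "0 < t" "2 * (x + c * t) = of_int \<lfloor>2 * x\<rfloor> + 1"
proof (rule that[of "((of_int \<lfloor>2 * x\<rfloor> + 1) / 2 - x) / c"])
  have "2 * x < of_int \<lfloor>2 * x\<rfloor> + 1" by (rule real_of_int_floor_add_one_gt)
  then have "0 < (of_int \<lfloor>2 * x\<rfloor> + 1) / 2 - x" by (simp add: field_simps)
  then show "0 < ((of_int \<lfloor>2 * x\<rfloor> + 1) / 2 - x) / c" using assms by (rule divide_pos_pos)
qed (use assms in \<open>simp add: field_simps\<close>)

lemma billiard_flight:
  assumes a: "0 < a" "a < 1/2" and cs: "0 < c" "0 \<le> s" and "0 < t"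
    and "\<And>r. 0 < r \<Longrightarrow> r < t \<Longrightarrow> frac (x + c * r) \<noteq> 1 - a"
  shows "(billiard_step a b)\<^sup>+\<^sup>+ (unfolded c s x y) (arrival a b c s (x + c * t) (y + s * t))"
  using assms(5-)
proof (induction "nat (\<lfloor>2 * (x + c * t)\<rfloor> + \<lfloor>2 * (y + s * t)\<rfloor> - \<lfloor>2 * x\<rfloor> - \<lfloor>2 * y\<rfloor>)"
    arbitrary: x y t rule: less_induct)
  case (less x y t)
  show ?case
  proof (cases "2 * (x + c * t) \<le> of_int \<lfloor>2 * x\<rfloor> + 1 \<and> 2 * (y + s * t) \<le> of_int \<lfloor>2 * y\<rfloor> + 1")
    case True
    then have "billiard_step a b (unfolded c s x y) (arrival a b c s (x + c * t) (y + s * t))"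
      using billiard_step_half_cell[OF a cs less.prems(1)] less.prems(2) by blast
    then show ?thesis by (rule tranclp.r_into_trancl)
  next
    case False
    obtain tx where tx: "tx > 0" "2 * (x + c * tx) = of_int \<lfloor>2 * x\<rfloor> + 1"
      using next_wall[OF cs(1)] by blast
    obtain ty where ty: "ty > 0" "s \<noteq> 0 \<Longrightarrow> 2 * (y + s * ty) = of_int \<lfloor>2 * y\<rfloor> + 1"
      using next_wall[of s y] cs(2) tx(1) by (metis order_le_less)
    define \<tau> where "\<tau> = (if s = 0 then tx else min tx ty)"
    have \<tau>0: "\<tau> > 0" using tx ty by (auto simp: \<tau>_def)
    have "\<tau> \<le> tx" by (auto simp: \<tau>_def)
    then have "c * \<tau> \<le> c * tx" using cs by (intro mult_left_mono) auto
    then have x1: "2 * (x + c * \<tau>) \<le> of_int \<lfloor>2 * x\<rfloor> + 1" by (simp flip: tx(2))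
    have y1: "2 * (y + s * \<tau>) \<le> of_int \<lfloor>2 * y\<rfloor> + 1"
    proof (cases "s = 0")
      case False
      then have "s * \<tau> \<le> s * ty" using cs by (intro mult_left_mono) (auto simp: \<tau>_def)
      then show ?thesis using False by (simp flip: ty(2))
    next
      case True
      then show ?thesis using real_of_int_floor_add_one_gt[of "2 * y"] by simp
    qed
    have "\<tau> < t"
    proof (rule ccontr)
      assume "\<not> \<tau> < t"
      then have "c * t \<le> c * \<tau>" "s * t \<le> s * \<tau>" using cs by (auto intro: mult_left_mono)
      then have "2 * (x + c * t) \<le> 2 * (x + c * \<tau>)" "2 * (y + s * t) \<le> 2 * (y + s * \<tau>)" by simp_all
      then show False using False x1 y1 by (meson order_trans)
    qed
    have mono: "2 * x \<le> 2 * (x + c * \<tau>)" "2 * y \<le> 2 * (y + s * \<tau>)"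
       "2 * (x + c * \<tau>) \<le> 2 * (x + c * t)" "2 * (y + s * \<tau>) \<le> 2 * (y + s * t)"
      using cs \<tau>0 \<open>\<tau> < t\<close> by (auto intro: mult_left_mono)
    have fl: "\<lfloor>2 * x\<rfloor> \<le> \<lfloor>2 * (x + c * \<tau>)\<rfloor>" "\<lfloor>2 * y\<rfloor> \<le> \<lfloor>2 * (y + s * \<tau>)\<rfloor>"
      "\<lfloor>2 * (x + c * \<tau>)\<rfloor> \<le> \<lfloor>2 * (x + c * t)\<rfloor>" "\<lfloor>2 * (y + s * \<tau>)\<rfloor> \<le> \<lfloor>2 * (y + s * t)\<rfloor>"
      using mono by (auto intro: floor_mono)
    have "2 * (x + c * \<tau>) = of_int \<lfloor>2 * x\<rfloor> + 1 \<or> 2 * (y + s * \<tau>) = of_int \<lfloor>2 * y\<rfloor> + 1"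
      using tx ty unfolding \<tau>_def by (auto simp: min_def)
    then have step: "\<lfloor>2 * (x + c * \<tau>)\<rfloor> = \<lfloor>2 * x\<rfloor> + 1 \<or> \<lfloor>2 * (y + s * \<tau>)\<rfloor> = \<lfloor>2 * y\<rfloor> + 1"
      by linarith
    have "billiard_step a b (unfolded c s x y) (arrival a b c s (x + c * \<tau>) (y + s * \<tau>))"
      using billiard_step_half_cell[OF a cs \<tau>0 x1 y1] less.prems(2) \<open>\<tau> < t\<close> by force
    moreover have "arrival a b c s (x + c * \<tau>) (y + s * \<tau>) = unfolded c s (x + c * \<tau>) (y + s * \<tau>)"
      using less.prems(2)[OF \<tau>0 \<open>\<tau> < t\<close>] by (simp add: arrival_def)
    moreover have "(billiard_step a b)\<^sup>+\<^sup>+ (unfolded c s (x + c * \<tau>) (y + s * \<tau>))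
        (arrival a b c s (x + c * \<tau> + c * (t - \<tau>)) (y + s * \<tau> + s * (t - \<tau>)))"
    proof (rule less.hyps)
      have eq: "x + c * \<tau> + c * (t - \<tau>) = x + c * t" "y + s * \<tau> + s * (t - \<tau>) = y + s * t"
        by (simp_all add: algebra_simps)
      show "nat (\<lfloor>2 * (x + c * \<tau> + c * (t - \<tau>))\<rfloor> + \<lfloor>2 * (y + s * \<tau> + s * (t - \<tau>))\<rfloor>
            - \<lfloor>2 * (x + c * \<tau>)\<rfloor> - \<lfloor>2 * (y + s * \<tau>)\<rfloor>)
          < nat (\<lfloor>2 * (x + c * t)\<rfloor> + \<lfloor>2 * (y + s * t)\<rfloor> - \<lfloor>2 * x\<rfloor> - \<lfloor>2 * y\<rfloor>)"
        unfolding eq using fl step by linarith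
      show "0 < t - \<tau>" using \<open>\<tau> < t\<close> by simp
      show "frac (x + c * \<tau> + c * r) \<noteq> 1 - a" if "0 < r" "r < t - \<tau>" for r
        using less.prems(2)[of "\<tau> + r"] that \<tau>0 by (auto simp: algebra_simps)
    qed
    ultimately show ?thesis by (simp add: algebra_simps)
  qed
qed

section \<open>Rational directions are exceptional\<close>

locale unfolded_mirror =
  fixes a b c s :: real
  assumes a: "0 < a" "a < 1/2" and b: "0 < b" "b < 1/2" and cs: "0 < c" "0 \<le> s"
begin

text \<open>Position of \<open>y\<close> below the upper end of the mirror; the half-open mirror \<open>(-b, b]\<close> modulo one is
  \<open>below y < 2 * b\<close>. With this convention a point can be pushed up to the next end point of
  the mirror, that is by \<open>gap y\<close>, and still takes the same branch of \<open>return\<close>.\<close>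

definition below :: "real \<Rightarrow> real" where "below y = frac (b - y)"

definition gap :: "real \<Rightarrow> real" where
  "gap y = (if below y < 2 * b then below y else below y - 2 * b)"

definition return :: "real \<Rightarrow> real" where
  "return y = (if below y < 2 * b then y + (1 - 2 * a) * (s / c) else y + s / c)"

definition launch :: "real \<Rightarrow> (real \<times> real) \<times> (real \<times> real)" where
  "launch y = (if below y < 2 * b then unfolded c s a y else unfolded c s (1 - a) y)"

lemma below_bounds: "0 \<le> below y" "below y < 1"
  by (simp_all add: below_def frac_lt_1)

lemma gap_nonneg: "0 \<le> gap y"
  using below_bounds by (auto simp: gap_def)

lemma tri_le_iff: "tri y \<le> b \<longleftrightarrow> below y \<le> 2 * b"
proof -
  obtain m :: int where y: "y = b - below y - m"
    by (rule that[of "\<lfloor>b - y\<rfloor>"]) (simp add: below_def frac_def)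
  have w: "0 \<le> below y" "below y < 1" by (fact below_bounds)+
  have "frac y = (if below y \<le> b then b - below y else b - below y + 1)"
    using w b y frac_eqI[of y "- m" "b - below y"] frac_eqI[of y "- m - 1" "b - below y + 1"] by auto
  then show ?thesis using w b by (auto simp: tri_def min_def)
qed

lemma arrival_eq_launch:
  assumes "gap y \<noteq> 0"
  shows "arrival a b c s (1 - a) y = launch y"
proof -
  have "frac (1 - a) = 1 - a" using a by (simp add: frac_eq)
  moreover have "tri y \<le> b \<longleftrightarrow> below y < 2 * b"
    using assms tri_le_iff[of y] by (auto simp: gap_def split: if_splits)
  ultimately show ?thesis by (simp add: arrival_def launch_def)
qed

lemma end_point_of_gap:
  assumes "gap y = 0"
  shows "tri y = b" "fst (launch y) = (a, b)" "fst (arrival a b c s (1 - a) y) = (a, b)"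
proof -
  have "below y = 0 \<or> below y = 2 * b" using assms by (auto simp: gap_def split: if_splits)
  then have "frac (b - y) = 0 \<or> frac (b - y) = 2 * b" by (simp add: below_def)
  then have m: "y = b - \<lfloor>b - y\<rfloor> \<or> y = - b - \<lfloor>b - y\<rfloor>"
    unfolding frac_def by linarith
  have "frac y = b \<or> frac y = 1 - b"
    using m b frac_eqI[of y "- \<lfloor>b - y\<rfloor>" b] frac_eqI[of y "- \<lfloor>b - y\<rfloor> - 1" "1 - b"] by auto
  then show *: "tri y = b" using b by (auto simp: tri_def min_def)
  have f: "frac (1 - a) = 1 - a" using a by (simp add: frac_eq)
  show "fst (launch y) = (a, b)" "fst (arrival a b c s (1 - a) y) = (a, b)"
    using * frac_left_state[OF a] frac_mirror_state[OF f a] f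
    by (auto simp: launch_def arrival_def unfolded_def)
qed

lemma launch_directions: "snd (launch y) \<in> {c, - c} \<times> {s, - s}"
  by (auto simp: launch_def unfolded_def dir_def)

lemma launch_return: "(billiard_step a b)\<^sup>+\<^sup>+ (launch y) (arrival a b c s (1 - a) (return y))"
proof (cases "below y < 2 * b")
  case True
  have "(billiard_step a b)\<^sup>+\<^sup>+ (unfolded c s a y)
     (arrival a b c s (a + c * ((1 - 2 * a) / c)) (y + s * ((1 - 2 * a) / c)))"
  proof (rule billiard_flight[OF a cs])
    show "0 < (1 - 2 * a) / c" using a cs by simp
    fix r assume r: "0 < r" "r < (1 - 2 * a) / c"
    then have "0 < c * r" "c * r < 1 - 2 * a" using cs by (auto simp: field_simps)
    then show "frac (a + c * r) \<noteq> 1 - a" using a by (auto simp: frac_unique_iff elim!: Ints_cases)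
  qed
  moreover have "a + c * ((1 - 2 * a) / c) = 1 - a" "y + s * ((1 - 2 * a) / c) = return y"
    using True cs by (simp_all add: return_def)
  ultimately show ?thesis using True by (simp add: launch_def del: times_divide_eq_right)
next
  case False
  have "(billiard_step a b)\<^sup>+\<^sup>+ (unfolded c s (1 - a) y)
     (arrival a b c s (1 - a + c * (1 / c)) (y + s * (1 / c)))"
  proof (rule billiard_flight[OF a cs])
    show "0 < 1 / c" using cs by simp
    fix r assume r: "0 < r" "r < 1 / c"
    then have "0 < c * r" "c * r < 1" using cs by (auto simp: field_simps)
    then show "frac (1 - a + c * r) \<noteq> 1 - a" using a by (auto simp: frac_unique_iff elim!: Ints_cases)
  qed
  moreover have "arrival a b c s (1 - a + c * (1 / c)) z = arrival a b c s (1 - a) z" for z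
    using cs unfolded_add_1[of c s "1 - a" z] frac_1_eq[of "1 - a"] by (simp add: arrival_def)
  ultimately show ?thesis using False by (simp add: launch_def return_def)
qed

lemma connection_of_gaps:
  assumes "gap y = 0" "n > 0" "gap ((return ^^ n) y) = 0"
  obtains v w where "v \<in> {c, - c} \<times> {s, - s}" "(billiard_step a b)\<^sup>+\<^sup>+ ((a, b), v) ((a, b), w)"
proof -
  define N where "N = (LEAST n. n > 0 \<and> gap ((return ^^ n) y) = 0)"
  have N: "N > 0" "gap ((return ^^ N) y) = 0"
    using LeastI[of "\<lambda>n. n > 0 \<and> gap ((return ^^ n) y) = 0" n] assms by (auto simp: N_def)
  have min: "gap ((return ^^ k) y) \<noteq> 0" if "0 < k" "k < N" for k
    using not_less_Least[of k "\<lambda>n. n > 0 \<and> gap ((return ^^ n) y) = 0"] that by (auto simp: N_def)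
  have "(billiard_step a b)\<^sup>+\<^sup>+ (launch y) (arrival a b c s (1 - a) ((return ^^ Suc k) y))" if "k < N" for k
    using that
  proof (induction k)
    case (Suc k)
    then have "(billiard_step a b)\<^sup>+\<^sup>+ (launch y) (launch ((return ^^ Suc k) y))"
      using arrival_eq_launch[OF min[of "Suc k"]] by simp
    then show ?case using launch_return[of "(return ^^ Suc k) y"] by simp
  qed (simp add: launch_return)
  from this[of "N - 1"] have "(billiard_step a b)\<^sup>+\<^sup>+ (launch y) (arrival a b c s (1 - a) ((return ^^ N) y))"
    using N by simp
  moreover have "launch y = ((a, b), snd (launch y))"
    using end_point_of_gap(2)[OF assms(1)] by (metis prod.collapse)
  moreover have "arrival a b c s (1 - a) ((return ^^ N) y) = ((a, b), snd (arrival a b c s (1 - a) ((return ^^ N) y)))"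
    using end_point_of_gap(3)[OF N(2)] by (metis prod.collapse)
  ultimately show thesis using launch_directions[of y] that by metis
qed

lemma below_push: "0 \<le> d \<Longrightarrow> d \<le> gap y \<Longrightarrow> below (y + d) = below y - d"
  unfolding below_def frac_unique_iff
  using below_bounds[of y] b by (auto simp: gap_def below_def frac_def split: if_splits)

lemma gap_push:
  assumes "0 \<le> d" "d \<le> gap y"
  shows "gap (y + d) = gap y - d" "return (y + d) = return y + d"
  using below_push[OF assms] assms below_bounds[of y] b
  by (auto simp: gap_def return_def split: if_splits)

lemma period_one:
  assumes "x - y \<in> \<int>"
  shows "gap x = gap y" "return x - return y = x - y"
proof -
  have "b - x = (b - y) + - (x - y)" by simp
  then have "below x = below y"
    unfolding below_def using assms by (metis Ints_minus frac_add_int_right)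
  then show "gap x = gap y" "return x - return y = x - y" by (auto simp: gap_def return_def)
qed

lemma return_period:
  assumes "x - y \<in> \<int>"
  shows "(return ^^ n) x - (return ^^ n) y = x - y"
  using assms period_one by (induction n) auto

lemma connection_of_periodic:
  assumes "n > 0" "(return ^^ n) y - y \<in> \<int>"
  obtains v w where "v \<in> {c, - c} \<times> {s, - s}" "(billiard_step a b)\<^sup>+\<^sup>+ ((a, b), v) ((a, b), w)"
proof -
  define g where "g = (\<lambda>i. gap ((return ^^ i) y))"
  have per: "g (i + n) = g i" for i
    unfolding g_def funpow_add o_apply
    by (rule period_one) (use return_period[OF assms(2), of i] assms(2) in simp)
  define d where "d = Min (g ` {..<n})"
  have "d \<in> g ` {..<n}" unfolding d_def using assms(1) by (intro Min_in) auto
  then obtain j where j: "j < n" "g j = d" by auto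
  have d_le: "d \<le> g i" for i
  proof (induction i rule: less_induct)
    case (less i)
    show ?case
    proof (cases "i < n")
      case True then show ?thesis unfolding d_def by (intro Min_le) auto
    next
      case False
      then show ?thesis using less[of "i - n"] per[of "i - n"] assms(1) by simp
    qed
  qed
  have d0: "0 \<le> d" using j gap_nonneg[of "(return ^^ j) y"] by (simp add: g_def)
  have push: "(return ^^ i) (y + d) = (return ^^ i) y + d" for i
    by (induction i) (use gap_push(2)[OF d0] d_le in \<open>auto simp: g_def\<close>)
  have gp: "gap ((return ^^ i) (y + d)) = g i - d" for i
    unfolding push using gap_push(1)[OF d0 d_le[of i, unfolded g_def]] by (simp add: g_def)
  show thesis
  proof (rule connection_of_gaps[OF _ assms(1)])
    show "gap ((return ^^ j) (y + d)) = 0" using gp[of j] j by simp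
    have "(return ^^ n) ((return ^^ j) (y + d)) = (return ^^ (j + n)) (y + d)"
      by (metis add.commute comp_apply funpow_add)
    then show "gap ((return ^^ n) ((return ^^ j) (y + d))) = 0" using gp[of "j + n"] per[of j] j by simp
  qed (rule that)
qed

lemma periodic_of_rational:
  assumes "a \<in> \<rat>" "s / c \<in> \<rat>"
  obtains n y where "n > 0" "(return ^^ n) y - y \<in> \<int>"
proof -
  obtain D :: int where D: "D > 0" "D * ((1 - 2 * a) * (s / c)) \<in> \<int>" "D * (s / c) \<in> \<int>"
  proof -
    obtain m1 d1 where 1: "d1 > 0" "a = of_int m1 / of_int d1" using Rats_cases'[OF assms(1)] by metis
    obtain m2 d2 where 2: "d2 > 0" "s / c = of_int m2 / of_int d2" using Rats_cases'[OF assms(2)] by metis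
    show thesis
    proof (rule that[of "d1 * d2"])
      have "of_int (d1 * d2) * ((1 - 2 * a) * (s / c)) = (of_int ((d1 - 2 * m1) * m2) :: real)"
        unfolding 1(2) 2(2) using 1(1) 2(1) by (simp add: field_simps)
      then show "of_int (d1 * d2) * ((1 - 2 * a) * (s / c)) \<in> \<int>" by (metis Ints_of_int)
      have "of_int (d1 * d2) * (s / c) = (of_int (d1 * m2) :: real)"
        unfolding 2(2) using 2(1) by (simp add: field_simps)
      then show "of_int (d1 * d2) * (s / c) \<in> \<int>" by (metis Ints_of_int)
    qed (use 1 2 in simp)
  qed
  define u where "u = (\<lambda>i. (return ^^ i) 0)"
  have Du: "D * u i \<in> \<int>" for i
    by (induction i) (use D in \<open>auto simp: u_def return_def distrib_left\<close>)
  define h where "h = (\<lambda>i. \<lfloor>D * u i\<rfloor> mod D)"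
  have "range h \<subseteq> {0..<D}" using D by (auto simp: h_def)
  then have "\<not> inj h" using finite_subset infinite_UNIV_nat finite_imageD by blast
  then obtain i j where ij: "i < j" "h i = h j" unfolding inj_def by (metis linorder_neqE_nat)
  then obtain k where k: "\<lfloor>D * u j\<rfloor> = \<lfloor>D * u i\<rfloor> + D * k"
    unfolding h_def by (metis mod_eqE)
  have fl: "D * u l = of_int \<lfloor>D * u l\<rfloor>" for l using of_int_floor_cancel[of "D * u l"] Du[of l] by simp
  have "D * u j = of_int \<lfloor>D * u j\<rfloor>" by (rule fl)
  also have "\<dots> = real_of_int \<lfloor>D * u i\<rfloor> + D * k" by (simp only: k of_int_add of_int_mult)
  also have "\<dots> = D * u i + D * k" by (simp only: fl[of i, symmetric])
  finally have "D * u j = D * u i + D * k" .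
  then have "of_int D * (u j - (u i + k)) = 0" by (simp add: algebra_simps)
  then have "u j = u i + k" using D by simp
  then have "(return ^^ (j - i)) (u i) - u i \<in> \<int>"
    using funpow_add[of "j - i" i return] ij(1) by (simp add: u_def)
  then show thesis using ij that[of "j - i" "u i"] by simp
qed

end

lemma nonexceptional_irrational:
  assumes "0 < a" "a < 1/2" and rat_a: "a \<in> \<rat>" and "0 < b" "b < 1/2"
    and ne: "\<not> exceptional a b \<theta>"
  shows "tan \<theta> \<notin> \<rat>"
proof
  assume rat: "tan \<theta> \<in> \<rat>"
  have cos: "cos \<theta> \<noteq> 0" using ne by (auto simp: exceptional_def)
  interpret unfolded_mirror a b "\<bar>cos \<theta>\<bar>" "\<bar>sin \<theta>\<bar>"
    by unfold_locales (use assms cos in auto)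
  have "\<bar>sin \<theta>\<bar> / \<bar>cos \<theta>\<bar> = \<bar>tan \<theta>\<bar>" by (simp add: tan_def)
  then have "\<bar>sin \<theta>\<bar> / \<bar>cos \<theta>\<bar> \<in> \<rat>" using rat by simp
  then obtain n y where "n > 0" "(return ^^ n) y - y \<in> \<int>"
    using periodic_of_rational rat_a by blast
  then obtain v w where v: "v \<in> {\<bar>cos \<theta>\<bar>, - \<bar>cos \<theta>\<bar>} \<times> {\<bar>sin \<theta>\<bar>, - \<bar>sin \<theta>\<bar>}"
    "(billiard_step a b)\<^sup>+\<^sup>+ ((a, b), v) ((a, b), w)"
    by (rule connection_of_periodic)
  have "\<bar>r\<bar> = r \<or> \<bar>r\<bar> = - r" for r :: real by (simp add: abs_if)
  then have "{\<bar>r\<bar>, - \<bar>r\<bar>} = {r, - r}" for r :: real by (metis add.inverse_inverse insert_commute)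
  then have "v \<in> directions \<theta>" using v(1) by (simp only: directions_def)
  then have "exceptional a b \<theta>" unfolding exceptional_def using v(2) by blast
  then show False using ne by simp
qed

section \<open>Rotations of the circle\<close>

lemma to_circle_cases: obtains x where "z = to_circle x"
  by (metis Quotient_abs_rep Quotient_circle)

lemma to_circle_eq_iff: "to_circle x = to_circle y \<longleftrightarrow> x - y \<in> \<int>"
  by (rule circle.abs_eq_iff)

lemma rotate_to_circle [simp]: "rotate s (to_circle y) = to_circle (y + s)"
  by (rule rotate.abs_eq)

lemma dist_to_circle: "dist (to_circle x) (to_circle y) = \<bar>x - y - of_int (round (x - y))\<bar>"
  by (simp add: dist_circle.abs_eq)

lemma dist_to_circle_le: "dist (to_circle x) (to_circle y) \<le> \<bar>x - y - of_int k\<bar>"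
  unfolding dist_to_circle by (rule round_diff_minimal)

lemma dist_rotate [simp]: "dist (rotate s x) (rotate s y) = dist x y"
  by (cases x rule: to_circle_cases, cases y rule: to_circle_cases) (simp add: dist_to_circle)

lemma rotate_rotate [simp]: "rotate s (rotate t y) = rotate (s + t) y"
  by (cases y rule: to_circle_cases) (simp add: ac_simps)

lemma rotate_0 [simp]: "rotate 0 y = y"
  by (cases y rule: to_circle_cases) simp

lemma continuous_on_rotate [continuous_intros]:
  assumes "continuous_on S f"
  shows "continuous_on S (\<lambda>x. rotate s (f x))"
proof -
  have "continuous_on UNIV (rotate s)" unfolding continuous_on_iff by auto
  then show ?thesis using assms by (rule continuous_on_compose2) simp
qed

lemma continuous_on_to_circle: "continuous_on S to_circle"
proof -
  have "dist (to_circle x) (to_circle y) \<le> dist x y" for x y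
    using dist_to_circle_le[of x y 0] by (simp add: dist_real_def)
  then show ?thesis unfolding continuous_on_iff by (meson le_less_trans)
qed

lemma compact_circle: "compact (UNIV :: circle set)"
proof -
  have "z \<in> to_circle ` {0..1}" for z
  proof (cases z rule: to_circle_cases)
    case (1 x)
    have "z = to_circle (frac x)" unfolding 1 to_circle_eq_iff by (simp add: frac_def)
    then show ?thesis by (intro image_eqI[of _ _ "frac x"]) (auto intro: less_imp_le frac_lt_1)
  qed
  then have "UNIV = to_circle ` {0..1}" by auto
  then show ?thesis using compact_continuous_image[OF continuous_on_to_circle, of "{0..1}"] by simp
qed

lemma open_to_circle_image:
  assumes "open U"
  shows "open (to_circle ` U)"
  unfolding open_dist
proof
  fix z assume "z \<in> to_circle ` U"
  then obtain x where x: "x \<in> U" "z = to_circle x" by auto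
  then obtain e where e: "e > 0" "\<And>y. dist y x < e \<Longrightarrow> y \<in> U" using assms by (auto simp: open_dist)
  have "w \<in> to_circle ` U" if "dist w z < e" for w
  proof (cases w rule: to_circle_cases)
    case (1 y)
    define k where "k = round (y - x)"
    have "y - of_int k \<in> U"
      using that unfolding 1 x(2) dist_to_circle by (intro e(2)) (simp add: dist_real_def k_def algebra_simps)
    moreover have "w = to_circle (y - of_int k)" unfolding 1 to_circle_eq_iff by simp
    ultimately show ?thesis by blast
  qed
  then show "\<exists>e>0. \<forall>w. dist w z < e \<longrightarrow> w \<in> to_circle ` U" using e(1) by blast
qed

lemma rotation_orbit_dense:
  assumes "\<alpha> \<notin> \<rat>" "e > 0"
  obtains m :: nat where "dist y' (rotate (real m * \<alpha>) y) < e"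
proof -
  obtain x where x: "y = to_circle x" by (rule to_circle_cases)
  obtain x' where x': "y' = to_circle x'" by (rule to_circle_cases)
  obtain h k where "k > 0" and k: "\<bar>of_int k * \<alpha> - of_int h - (x' - x)\<bar> < e"
    using sequence_of_fractional_parts_is_dense[OF assms] by metis
  have "\<bar>x' - (x + real (nat k) * \<alpha>) - of_int (- h)\<bar> < e"
    using k \<open>k > 0\<close> by (simp add: abs_if algebra_simps split: if_splits)
  then have "dist y' (rotate (real (nat k) * \<alpha>) y) < e"
    unfolding x x' rotate_to_circle using dist_to_circle_le[of x' "x + real (nat k) * \<alpha>" "- h"] by linarith
  then show thesis by (rule that)
qed

lemma rotation_uniformly_dense:
  assumes "\<alpha> \<notin> \<rat>" "e > 0"
  obtains N :: nat where "\<And>y y'. \<exists>m\<le>N. dist y' (rotate (real m * \<alpha>) y) < e"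
proof -
  define c where "c = to_circle 0"
  have cover: "UNIV \<subseteq> (\<Union>m. ball (rotate (real m * \<alpha>) c) e)"
  proof
    fix y' :: circle
    obtain m :: nat where "dist y' (rotate (real m * \<alpha>) c) < e" using rotation_orbit_dense[OF assms] by blast
    then show "y' \<in> (\<Union>m. ball (rotate (real m * \<alpha>) c) e)" by (auto simp: dist_commute)
  qed
  obtain F where F: "finite F" "UNIV \<subseteq> (\<Union>m\<in>F. ball (rotate (real m * \<alpha>) c) e)"
    by (rule compactE_image[OF compact_circle _ cover]) auto
  have "\<exists>m\<le>Max F. dist y' (rotate (real m * \<alpha>) y) < e" for y y'
  proof -
    obtain x where x: "y = rotate x c" unfolding c_def by (rule to_circle_cases[of y]) simp
    have "rotate (- x) y' \<in> (\<Union>m\<in>F. ball (rotate (real m * \<alpha>) c) e)" using F(2) by blast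
    then obtain m where m: "m \<in> F" "dist (rotate (real m * \<alpha>) c) (rotate (- x) y') < e" by auto
    have "dist (rotate (real m * \<alpha>) y) y' = dist (rotate (real m * \<alpha>) c) (rotate (- x) y')"
      unfolding x by (subst dist_rotate[of "- x", symmetric]) simp
    then show ?thesis using m F(1) by (metis Max_ge dist_commute)
  qed
  then show thesis by (rule that)
qed

section \<open>Unique ergodicity of irrational rotations\<close>

definition birkhoff_sum :: "real \<Rightarrow> (circle \<Rightarrow> real) \<Rightarrow> nat \<Rightarrow> circle \<Rightarrow> real" where
  "birkhoff_sum \<alpha> h n y = (\<Sum>k<n. h (rotate (real k * \<alpha>) y))"

lemma birkhoff_sum_shift:
  assumes "\<And>y. \<bar>h y\<bar> \<le> 1"
  shows "\<bar>birkhoff_sum \<alpha> h n (rotate (real m * \<alpha>) y) - birkhoff_sum \<alpha> h n y\<bar> \<le> 2 * real m"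
proof (induction m)
  case (Suc m)
  let ?z = "rotate (real m * \<alpha>) y"
  have z: "rotate (real (Suc m) * \<alpha>) y = rotate \<alpha> ?z" by (simp add: algebra_simps)
  have eq: "birkhoff_sum \<alpha> h n (rotate \<alpha> ?z) = (\<Sum>k<n. h (rotate (real (Suc k) * \<alpha>) ?z))"
    unfolding birkhoff_sum_def by (rule sum.cong) (simp_all add: algebra_simps)
  have "birkhoff_sum \<alpha> h n (rotate \<alpha> ?z) - birkhoff_sum \<alpha> h n ?z = h (rotate (real n * \<alpha>) ?z) - h ?z"
    unfolding eq unfolding birkhoff_sum_def
    using sum_lessThan_telescope[where f="\<lambda>k. h (rotate (real k * \<alpha>) ?z)" and m=n] by (simp add: sum_subtractf)
  moreover have "\<bar>u' - w\<bar> \<le> 2 * real (Suc m)"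
    if "u' - u = v' - v" "\<bar>u - w\<bar> \<le> 2 * real m" "\<bar>v'\<bar> \<le> 1" "\<bar>v\<bar> \<le> 1" for u u' v v' w :: real
  proof -
    have "u' - w = v' - v + (u - w)" using that(1) by simp
    then show ?thesis using that(2-) by (simp add: abs_le_iff)
  qed
  ultimately show ?case unfolding z using Suc assms by blast
qed simp

lemma birkhoff_sum_oscillation:
  assumes "\<alpha> \<notin> \<rat>" "continuous_on UNIV h" "\<And>y. \<bar>h y\<bar> \<le> 1" "e > 0"
  obtains N :: nat where
    "\<And>n y y'. \<bar>birkhoff_sum \<alpha> h n y' - birkhoff_sum \<alpha> h n y\<bar> \<le> real n * e + 2 * real N"
proof -
  have "uniformly_continuous_on UNIV h"
    using assms(2) compact_circle by (rule compact_uniformly_continuous)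
  then obtain d where d: "d > 0" "\<And>x y. dist x y < d \<Longrightarrow> \<bar>h x - h y\<bar> < e"
    unfolding uniformly_continuous_on_def dist_real_def using assms(4) by (metis UNIV_I)
  obtain N :: nat where N: "\<And>y y'. \<exists>m\<le>N. dist y' (rotate (real m * \<alpha>) y) < d"
    using rotation_uniformly_dense[OF assms(1) d(1)] by blast
  have "\<bar>birkhoff_sum \<alpha> h n y' - birkhoff_sum \<alpha> h n y\<bar> \<le> real n * e + 2 * real N" for n y y'
  proof -
    obtain m where m: "m \<le> N" "dist y' (rotate (real m * \<alpha>) y) < d" using N by blast
    have "\<bar>birkhoff_sum \<alpha> h n y' - birkhoff_sum \<alpha> h n (rotate (real m * \<alpha>) y)\<bar>
        \<le> (\<Sum>k<n. \<bar>h (rotate (real k * \<alpha>) y') - h (rotate (real k * \<alpha>) (rotate (real m * \<alpha>) y))\<bar>)"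
      unfolding birkhoff_sum_def sum_subtractf[symmetric] by (rule sum_abs)
    also have "\<dots> \<le> (\<Sum>k<n. e)"
      by (intro sum_mono less_imp_le d(2)) (use m(2) in \<open>simp del: rotate_rotate\<close>)
    finally have "\<bar>birkhoff_sum \<alpha> h n y' - birkhoff_sum \<alpha> h n (rotate (real m * \<alpha>) y)\<bar> \<le> real n * e" by simp
    then show ?thesis using birkhoff_sum_shift[of h \<alpha> n m y, OF assms(3)] m(1) by linarith
  qed
  then show thesis by (rule that)
qed

lemma integral_birkhoff_sum:
  assumes "prob_space M" "sets M = sets borel" "distr M borel (rotate \<alpha>) = M"
    and "continuous_on UNIV h" "\<And>y. \<bar>h y\<bar> \<le> 1"
  shows "integrable M (birkhoff_sum \<alpha> h n)" "(\<integral>y. birkhoff_sum \<alpha> h n y \<partial>M) = n * (\<integral>y. h y \<partial>M)"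
proof -
  interpret prob_space M by fact
  have M_borel: "measurable M borel = measurable borel borel"
    using assms(2) by (simp cong: measurable_cong_sets)
  have rot: "rotate s \<in> borel \<rightarrow>\<^sub>M borel" for s
    by (intro borel_measurable_continuous_onI continuous_intros)
  have cont: "continuous_on UNIV (\<lambda>y. h (rotate s y))" for s
    by (intro continuous_on_compose2[OF assms(4)] continuous_intros) auto
  have int: "integrable M (\<lambda>y. h (rotate s y))" for s
    by (rule integrable_const_bound[of _ 1]) (use assms(5) borel_measurable_continuous_onI[OF cont] in \<open>auto simp: M_borel\<close>)
  have step: "(\<integral>y. h (rotate (real k * \<alpha>) y) \<partial>M) = (\<integral>y. h y \<partial>M)" for k
  proof (induction k)
    case (Suc k)
    have "(\<integral>y. h (rotate (real k * \<alpha>) y) \<partial>M) = (\<integral>y. h (rotate (real k * \<alpha>) y) \<partial>(distr M borel (rotate \<alpha>)))"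
      using assms(3) by simp
    also have "\<dots> = (\<integral>y. h (rotate (real k * \<alpha>) (rotate \<alpha> y)) \<partial>M)"
      by (rule integral_distr) (auto simp: M_borel rot intro: borel_measurable_continuous_onI cont)
    finally show ?case using Suc by (simp add: algebra_simps)
  qed simp
  show "integrable M (birkhoff_sum \<alpha> h n)"
    unfolding birkhoff_sum_def by (intro Bochner_Integration.integrable_sum int)
  show "(\<integral>y. birkhoff_sum \<alpha> h n y \<partial>M) = n * (\<integral>y. h y \<partial>M)"
    unfolding birkhoff_sum_def by (subst Bochner_Integration.integral_sum) (use int step in auto)
qed

lemma rotation_invariant_integral_unique:
  fixes h :: "circle \<Rightarrow> real"
  assumes \<alpha>: "\<alpha> \<notin> \<rat>"
    and M: "prob_space M" "sets M = sets borel" "distr M borel (rotate \<alpha>) = M"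
    and N: "prob_space N" "sets N = sets borel" "distr N borel (rotate \<alpha>) = N"
    and h: "continuous_on UNIV h" "\<And>y. \<bar>h y\<bar> \<le> 1"
  shows "(\<integral>y. h y \<partial>M) = (\<integral>y. h y \<partial>N)"
proof (rule ccontr)
  let ?D = "\<bar>(\<integral>y. h y \<partial>M) - (\<integral>y. h y \<partial>N)\<bar>"
  assume "(\<integral>y. h y \<partial>M) \<noteq> (\<integral>y. h y \<partial>N)"
  then have D: "?D > 0" by simp
  then have D4: "?D / 4 > 0" by simp
  obtain K :: nat where K: "\<And>n y y'. \<bar>birkhoff_sum \<alpha> h n y' - birkhoff_sum \<alpha> h n y\<bar> \<le> real n * (?D / 4) + 2 * real K"
    by (rule birkhoff_sum_oscillation[OF \<alpha> h(1) h(2) D4]) blast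
  define c where "c = to_circle 0"
  have near: "\<bar>n * (\<integral>y. h y \<partial>L) - birkhoff_sum \<alpha> h n c\<bar> \<le> real n * (?D / 4) + 2 * real K"
    if "prob_space L" "sets L = sets borel" "distr L borel (rotate \<alpha>) = L" for L n
  proof -
    interpret prob_space L by fact
    note i = integral_birkhoff_sum[OF that h, of n]
    have "\<bar>(\<integral>y. birkhoff_sum \<alpha> h n y - birkhoff_sum \<alpha> h n c \<partial>L)\<bar>
       \<le> (\<integral>y. \<bar>birkhoff_sum \<alpha> h n y - birkhoff_sum \<alpha> h n c\<bar> \<partial>L)" by (rule integral_abs_bound)
    also have "\<dots> \<le> (\<integral>y. real n * (?D / 4) + 2 * real K \<partial>L)"
      by (rule integral_mono) (use i(1) K in auto)
    finally show ?thesis using i by (simp add: prob_space)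
  qed
  have bound: "real n * ?D \<le> real n * (?D / 2) + 4 * real K" for n
  proof -
    have "real n * ?D = \<bar>n * (\<integral>y. h y \<partial>M) - n * (\<integral>y. h y \<partial>N)\<bar>" by (simp add: abs_mult flip: right_diff_distrib)
    then show ?thesis using near[OF M, of n] near[OF N, of n] by linarith
  qed
  obtain n :: nat where "real n > 8 * real K / ?D" using reals_Archimedean2 by blast
  then have "real n * ?D > 8 * real K" using D by (simp add: pos_divide_less_eq)
  then show False using bound[of n] by linarith
qed

lemma closed_measure_eq_of_integrals:
  fixes M N :: "'a::metric_space measure"
  assumes M: "prob_space M" "sets M = sets borel" and N: "prob_space N" "sets N = sets borel"
    and eq: "\<And>h. continuous_on UNIV h \<Longrightarrow> (\<And>y. \<bar>h y\<bar> \<le> (1::real)) \<Longrightarrow> (\<integral>y. h y \<partial>M) = (\<integral>y. h y \<partial>N)"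
    and "closed K"
  shows "measure M K = measure N K"
proof (cases "K = {}")
  case False
  define h where "h = (\<lambda>n y. max 0 (1 - real n * infdist y K))"
  have cont: "continuous_on UNIV (h n)" for n
    unfolding h_def by (intro continuous_intros)
  have bd: "\<bar>h n y\<bar> \<le> 1" for n y
    unfolding h_def using infdist_nonneg[of y K] by (auto simp: max_def)
  have lim: "(\<lambda>n. h n y) \<longlonglongrightarrow> indicator K y" for y
  proof (cases "y \<in> K")
    case True then show ?thesis by (simp add: h_def)
  next
    case out: False
    then have pos: "infdist y K > 0"
      using \<open>closed K\<close> False in_closed_iff_infdist_zero infdist_nonneg[of y K] by force
    obtain n0 :: nat where n0: "real n0 * infdist y K > 1" using reals_Archimedean3[OF pos] by blast
    have "h n y = 0" if "n \<ge> n0" for n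
    proof -
      have "real n0 * infdist y K \<le> real n * infdist y K" using that pos by (intro mult_right_mono) auto
      then show ?thesis using n0 by (simp add: h_def)
    qed
    then have "eventually (\<lambda>n. h n y = 0) sequentially" by (auto simp: eventually_sequentially)
    then show ?thesis using out by (auto intro: tendsto_eventually)
  qed
  have "(\<lambda>n. \<integral>y. h n y \<partial>L) \<longlonglongrightarrow> measure L K" if "prob_space L" "sets L = sets borel" for L
  proof -
    interpret prob_space L by fact
    have "(\<lambda>n. \<integral>y. h n y \<partial>L) \<longlonglongrightarrow> (\<integral>y. indicator K y \<partial>L)"
    proof (rule integral_dominated_convergence[where w="\<lambda>_. 1"])
      show "h n \<in> borel_measurable L" for n
        using borel_measurable_continuous_onI[OF cont] that(2) by (simp cong: measurable_cong_sets)
      show "(indicator K :: 'a \<Rightarrow> real) \<in> borel_measurable L" 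
        by (intro borel_measurable_indicator) (simp add: that(2) \<open>closed K\<close>)
    qed (use lim bd in auto)
    then show ?thesis using sets_eq_imp_space_eq[OF that(2)] by simp
  qed
  from this[OF M] this[OF N] show ?thesis using eq[OF cont bd] by (auto intro: LIMSEQ_unique)
qed simp

lemma rotation_uniquely_ergodic:
  assumes \<alpha>: "\<alpha> \<notin> \<rat>"
    and M: "prob_space M" "sets M = sets borel" "distr M borel (rotate \<alpha>) = M"
    and N: "prob_space N" "sets N = sets borel" "distr N borel (rotate \<alpha>) = N"
  shows "M = N"
proof (rule measure_eqI_generator_eq[where E="{S. open S}" and \<Omega>=UNIV and A="\<lambda>_. UNIV"])
  interpret M: prob_space M by fact
  interpret N: prob_space N by fact
  have sp: "space M = UNIV" "space N = UNIV" using sets_eq_imp_space_eq[OF M(2)] sets_eq_imp_space_eq[OF N(2)] by auto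
  show "sets M = sigma_sets UNIV {S. open S}" "sets N = sigma_sets UNIV {S. open S}"
    using M(2) N(2) by (simp_all add: borel_def)
  show "emeasure M X = emeasure N X" if "X \<in> {S. open S}" for X
  proof -
    have "measure M (- X) = measure N (- X)"
      by (rule closed_measure_eq_of_integrals[OF M(1,2) N(1,2)])
        (use that rotation_invariant_integral_unique[OF \<alpha> M N] in auto)
    moreover have "X \<in> sets M" "X \<in> sets N" using that M(2) N(2) by auto
    ultimately have "measure M X = measure N X"
      using M.prob_compl[of X] N.prob_compl[of X] sp by (simp add: Compl_eq_Diff_UNIV)
    then show ?thesis by (simp add: M.emeasure_eq_measure N.emeasure_eq_measure)
  qed
next
  show "emeasure M UNIV \<noteq> \<infinity>" using prob_space.finite_measure[OF M(1)] by (simp add: finite_measure.emeasure_finite)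
qed (auto simp: Int_stable_def)

section \<open>Separation of ergodic measures\<close>

text \<open>A set maximising \<open>M - N\<close> has maximising preimages, so their limes superior maximises
  \<open>M - N\<close> as well; it is invariant.\<close>

lemma ergodic_measures_separated:
  fixes f :: "'a::topological_space \<Rightarrow> 'a"
  assumes f: "f \<in> borel \<rightarrow>\<^sub>M borel"
    and M: "ergodic_measure_on f C M" and N: "ergodic_measure_on f C N" and "M \<noteq> N"
  obtains A where "A \<in> sets borel" "emeasure M A = 1" "emeasure N A = 0"
proof -
  have M': "prob_space M" "sets M = sets borel" "\<And>A. A \<in> sets borel \<Longrightarrow> emeasure M (f -` A) = emeasure M A"
    and N': "prob_space N" "sets N = sets borel" "\<And>A. A \<in> sets borel \<Longrightarrow> emeasure N (f -` A) = emeasure N A"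
    using M N by (auto simp: ergodic_measure_on_def invariant_measure_on_def)
  interpret M: prob_space M by fact
  interpret N: prob_space N by fact
  have sp: "space M = UNIV" "space N = UNIV" using sets_eq_imp_space_eq[OF M'(2)] sets_eq_imp_space_eq[OF N'(2)] by auto
  define d where "d = (\<lambda>X. measure M X - measure N X)"
  have add: "d (X \<union> Y) + d (X \<inter> Y) = d X + d Y" if "X \<in> sets borel" "Y \<in> sets borel" for X Y
    using that M.finite_measure_Union'[of X Y] N.finite_measure_Union'[of X Y]
      M.finite_measure_Diff'[of Y X] N.finite_measure_Diff'[of Y X] M'(2) N'(2)
    unfolding d_def by (simp add: Int_commute)
  obtain P where P: "P \<in> sets borel" "\<And>X. X \<in> sets borel \<Longrightarrow> X \<subseteq> P \<Longrightarrow> d X \<ge> 0"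
    "\<And>X. X \<in> sets borel \<Longrightarrow> X \<inter> P = {} \<Longrightarrow> d X \<le> 0"
    using finite_unsigned_Hahn_decomposition[OF M.finite_measure_axioms N.finite_measure_axioms] M'(2) N'(2)
    by (auto simp: d_def M.emeasure_eq_measure N.emeasure_eq_measure)
  have P_max: "d X \<le> d P" if X: "X \<in> sets borel" for X
  proof -
    have "d (X - P) \<le> 0" "d (P - X) \<ge> 0" using P(1) P(2)[of "P - X"] P(3)[of "X - P"] X by auto
    moreover have split: "d Y = d (Y - Z) + d (Y \<inter> Z)" if "Y \<in> sets borel" "Z \<in> sets borel" for Y Z
    proof -
      have "(Y - Z) \<union> (Y \<inter> Z) = Y" "(Y - Z) \<inter> (Y \<inter> Z) = {}" by auto
      then show ?thesis using add[of "Y - Z" "Y \<inter> Z"] that by (simp add: d_def)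
    qed
    ultimately show ?thesis using split[OF X P(1)] split[OF P(1) X] by (simp add: Int_commute)
  qed
  define maximal where "maximal = (\<lambda>X. X \<in> sets borel \<and> d X = d P)"
  have max_Un: "maximal (X \<union> Y)" if "maximal X" "maximal Y" for X Y
    using that add[of X Y] P_max[of "X \<union> Y"] P_max[of "X \<inter> Y"] by (auto simp: maximal_def)
  have max_inc: "maximal (\<Union>k. X k)" if "\<And>k. maximal (X k)" "incseq X" for X :: "nat \<Rightarrow> 'a set"
  proof -
    have s: "X k \<in> sets borel" for k using that by (auto simp: maximal_def)
    then have "(\<lambda>k. d (X k)) \<longlonglongrightarrow> d (\<Union>k. X k)"
      unfolding d_def using M'(2) N'(2) that(2)
      by (intro tendsto_diff M.finite_Lim_measure_incseq N.finite_Lim_measure_incseq) auto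
    moreover have "(\<lambda>k. d (X k)) = (\<lambda>k. d P)" using that by (auto simp: maximal_def)
    ultimately show ?thesis using s by (auto simp: maximal_def LIMSEQ_const_iff)
  qed
  have max_dec: "maximal (\<Inter>k. X k)" if "\<And>k. maximal (X k)" "decseq X" for X :: "nat \<Rightarrow> 'a set"
  proof -
    have s: "X k \<in> sets borel" for k using that by (auto simp: maximal_def)
    then have "(\<lambda>k. d (X k)) \<longlonglongrightarrow> d (\<Inter>k. X k)"
      unfolding d_def using M'(2) N'(2) that(2)
      by (intro tendsto_diff M.finite_Lim_measure_decseq N.finite_Lim_measure_decseq) auto
    moreover have "(\<lambda>k. d (X k)) = (\<lambda>k. d P)" using that by (auto simp: maximal_def)
    ultimately show ?thesis using s by (auto simp: maximal_def LIMSEQ_const_iff)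
  qed
  define Q where "Q = (\<lambda>n. (f ^^ n) -` P)"
  have max_Q: "maximal (Q n)" for n
  proof (induction n)
    case (Suc n)
    have "Q (Suc n) = f -` Q n" by (auto simp: Q_def funpow_swap1)
    then show ?case using Suc measurable_sets[OF f, of "Q n"] M'(3) N'(3)
      by (simp add: maximal_def d_def measure_def)
  qed (simp add: Q_def maximal_def P)
  define R where "R = (\<lambda>n. \<Union>k. \<Union>j\<le>k. Q (n + j))"
  have max_R: "maximal (R n)" for n
    unfolding R_def
  proof (rule max_inc)
    show "maximal (\<Union>j\<le>k. Q (n + j))" for k
    proof (induction k)
      case (Suc k)
      then show ?case using max_Un[OF max_Q[of "n + Suc k"]] by (simp add: atMost_Suc)
    qed (simp add: max_Q)
    show "incseq (\<lambda>k. \<Union>j\<le>k. Q (n + j))" by (force simp: incseq_def)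
  qed
  have R_iff: "x \<in> R n \<longleftrightarrow> (\<exists>m\<ge>n. (f ^^ m) x \<in> P)" for x n
    unfolding R_def Q_def by (auto simp: le_iff_add)
  define A where "A = (\<Inter>n. R n)"
  have "maximal A"
    unfolding A_def by (rule max_dec[OF max_R]) (auto simp: decseq_def R_iff, meson order_trans)
  then have A: "A \<in> sets borel" "d A = d P" by (auto simp: maximal_def)
  have "f x \<in> A \<longleftrightarrow> x \<in> A" for x
  proof -
    have "f x \<in> A \<longleftrightarrow> (\<forall>n. \<exists>m\<ge>n. (f ^^ Suc m) x \<in> P)"
      by (simp add: A_def R_iff funpow_swap1)
    also have "\<dots> \<longleftrightarrow> (\<forall>n. \<exists>m\<ge>n. (f ^^ m) x \<in> P)"
    proof (intro iffI allI)
      fix n assume L: "\<forall>n. \<exists>m\<ge>n. (f ^^ Suc m) x \<in> P"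
      show "\<exists>m\<ge>n. (f ^^ m) x \<in> P" using L le_SucI by blast
    next
      fix n assume L: "\<forall>n. \<exists>m\<ge>n. (f ^^ m) x \<in> P"
      then obtain m where "m \<ge> Suc n" "(f ^^ m) x \<in> P" by blast
      then show "\<exists>m\<ge>n. (f ^^ Suc m) x \<in> P" by (metis Suc_le_D Suc_le_mono)
    qed
    finally show ?thesis by (simp add: A_def R_iff)
  qed
  then have "f -` A = A" by auto
  then have 01: "emeasure M A = 0 \<or> emeasure M A = 1" "emeasure N A = 0 \<or> emeasure N A = 1"
    using M N A(1) by (auto simp: ergodic_measure_on_def)
  have "d P > 0"
  proof (rule ccontr)
    assume "\<not> d P > 0"
    then have le: "d X \<le> 0" if "X \<in> sets borel" for X using P_max[OF that] by simp
    have "d X = 0" if X: "X \<in> sets borel" for X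
      using le[OF X] le[of "- X"] X M.prob_compl[of X] N.prob_compl[of X] sp M'(2) N'(2)
      by (simp add: d_def Compl_eq_Diff_UNIV)
    then have "M = N"
      by (intro measure_eqI) (auto simp: M'(2) N'(2) d_def M.emeasure_eq_measure N.emeasure_eq_measure)
    then show False using \<open>M \<noteq> N\<close> by simp
  qed
  then have "measure M A > measure N A" using A(2) by (simp add: d_def)
  then have "emeasure M A = 1" "emeasure N A = 0"
    using 01 by (auto simp: M.emeasure_eq_measure N.emeasure_eq_measure)
  then show thesis using A(1) that by blast
qed

section \<open>Minimal components\<close>

lemma omega_limit_isCont:
  fixes f :: "'a::{first_countable_topology, t2_space} \<Rightarrow> 'a"
  assumes "z \<in> omega_limit f x" "isCont f z"
  shows "f z \<in> omega_limit f x"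
  unfolding omega_limit_def
proof
  fix N :: nat
  define T where "T = {(f ^^ n) x | n. n \<ge> N}"
  have "z \<in> closure T" using assms(1) by (auto simp: omega_limit_def T_def)
  then obtain u where u: "\<And>n. u n \<in> T" "u \<longlonglongrightarrow> z" by (auto simp: closure_sequential)
  have "(\<lambda>n. f (u n)) \<longlonglongrightarrow> f z" using assms(2) u(2) by (rule isCont_tendsto_compose)
  moreover have "f (u n) \<in> T" for n
  proof -
    obtain k where "k \<ge> N" "u n = (f ^^ k) x" using u(1)[of n] by (auto simp: T_def)
    then show ?thesis unfolding T_def by (auto intro!: exI[of _ "Suc k"])
  qed
  ultimately show "f z \<in> closure T"
    unfolding closure_sequential by (intro exI[of _ "\<lambda>n. f (u n)"]) simp
qed

lemma closed_omega_limit: "closed (omega_limit f x)"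
  by (auto simp: omega_limit_def)

lemma orbit_subset_omega_limit:
  fixes f :: "'a::{first_countable_topology, t2_space} \<Rightarrow> 'a"
  assumes "z \<in> omega_limit f x" "\<And>n. isCont f ((f ^^ n) z)"
  shows "orbit f z \<subseteq> omega_limit f x"
proof -
  have "(f ^^ n) z \<in> omega_limit f x" for n
    by (induction n) (use assms omega_limit_isCont in auto)
  then show ?thesis by (auto simp: orbit_def)
qed

lemma minimal_component_eq_of_common_point:
  fixes f :: "'a::{first_countable_topology, t2_space} \<Rightarrow> 'a"
  assumes C: "minimal_component X f C" and D: "minimal_component X f D"
    and z: "z \<in> C" "z \<in> D" "\<And>n. isCont f ((f ^^ n) z)"
  shows "C = D"
proof -
  obtain x y where "C = omega_limit f x" "D = omega_limit f y"
    using C D by (auto simp: minimal_component_def)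
  then have "closed C" "closed D" "orbit f z \<subseteq> C" "orbit f z \<subseteq> D"
    using orbit_subset_omega_limit z by (auto simp: closed_omega_limit)
  then show ?thesis using C D closure_minimal unfolding minimal_component_def by (metis subset_antisym subset_trans)
qed

locale irrational_itm =
  fixes p q :: nat and b \<theta> :: real
  assumes p: "p < q" and irrational: "tan \<theta> / real q \<notin> \<rat>"
begin

abbreviation "S \<equiv> itm p q b \<theta>"
abbreviation "\<alpha> \<equiv> tan \<theta> / real q"

lemma itm_eq:
  "S = (\<lambda>z. (if fst z = q - p \<and> snd z \<in> to_circle ` {- b..b} then p else (fst z + 1) mod q,
             rotate \<alpha> (snd z)))"
  by (auto simp: itm_def fun_eq_iff)

lemma fst_itm: "fst (S z) < q"
  using p by (simp add: itm_eq)

lemma snd_itm: "snd (S z) = rotate \<alpha> (snd z)"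
  by (simp add: itm_eq)

lemma snd_itm_funpow: "snd ((S ^^ n) z) = rotate (real n * \<alpha>) (snd z)"
  by (induction n) (simp_all add: snd_itm algebra_simps add_divide_distrib)

lemma itm_funpow_sections: "z \<in> sections q \<Longrightarrow> (S ^^ n) z \<in> sections q"
  by (induction n) (auto simp: sections_def fst_itm mem_Times_iff)

lemma closed_mirror_arc: "closed (to_circle ` {- b..b})"
  by (intro compact_imp_closed compact_continuous_image continuous_on_to_circle) simp

lemma measurable_itm: "S \<in> borel \<rightarrow>\<^sub>M borel"
proof -
  define Z where "Z = {q - p} \<times> to_circle ` {- b..b}"
  have "Z \<in> sets borel"
    unfolding Z_def by (intro borel_closed closed_Times closed_mirror_arc) simp
  moreover have "S = (\<lambda>z. if z \<in> Z then (p, rotate \<alpha> (snd z)) else ((fst z + 1) mod q, rotate \<alpha> (snd z)))"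
    by (auto simp: itm_eq Z_def fun_eq_iff)
  moreover have "continuous_on A (\<lambda>z. (fst z + 1) mod q)" for A :: "(nat \<times> circle) set"
    by (rule continuous_on_compose2[OF _ continuous_on_fst[OF continuous_on_id], of UNIV]) (auto intro: continuous_on_discrete)
  ultimately show ?thesis
    by (auto intro!: borel_measurable_continuous_on_if continuous_on_Pair continuous_on_rotate continuous_on_snd continuous_on_const continuous_on_id)
qed

lemma isCont_itm:
  assumes "y \<notin> {to_circle b, to_circle (- b)}"
  shows "isCont S (i, y)"
proof -
  define K where "K = to_circle ` {- b..b}"
  obtain U where U: "open U" "y \<in> U" "\<And>w. w \<in> U \<Longrightarrow> w \<in> K \<longleftrightarrow> y \<in> K"
  proof (cases "y \<in> K")
    case True
    have "y \<in> to_circle ` {- b<..<b}"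
      using True assms by (force simp: K_def less_le)
    then show thesis using open_to_circle_image[of "{- b<..<b}"] True
      by (intro that[of "to_circle ` {- b<..<b}"]) (auto simp: K_def)
  next
    case False
    then show thesis using closed_mirror_arc that[of "- K"] by (auto simp: K_def)
  qed
  define g where "g = (\<lambda>z :: nat \<times> circle. if fst z = q - p \<and> snd z \<in> K then p else (fst z + 1) mod q)"
  have "eventually (\<lambda>z. z \<in> {i} \<times> U) (nhds (i, y))"
    using U by (intro eventually_nhds_in_open open_Times open_discrete) auto
  then have "eventually (\<lambda>z. g z = g (i, y)) (at (i, y))"
    unfolding eventually_at_filter
  proof (rule eventually_mono)
    fix z assume "z \<in> {i} \<times> U"
    then have "fst z = i" "snd z \<in> K \<longleftrightarrow> y \<in> K" using U(3) by auto
    then show "z \<noteq> (i, y) \<longrightarrow> z \<in> UNIV \<longrightarrow> g z = g (i, y)" by (simp add: g_def)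
  qed
  then have "isCont g (i, y)" unfolding isCont_def by (rule tendsto_eventually)
  moreover have "continuous_on UNIV (\<lambda>z :: nat \<times> circle. rotate \<alpha> (snd z))"
    by (intro continuous_on_rotate continuous_on_snd continuous_on_id)
  then have "isCont (\<lambda>z :: nat \<times> circle. rotate \<alpha> (snd z)) (i, y)"
    by (simp add: continuous_on_eq_continuous_at)
  ultimately have "isCont (\<lambda>z. (g z, rotate \<alpha> (snd z))) (i, y)" by (rule continuous_Pair)
  then show ?thesis by (simp add: itm_eq g_def K_def)
qed

lemma regular_fibre:
  obtains y where "\<And>i n. isCont S ((S ^^ n) (i, y))"
proof -
  define B where "B = (\<Union>n :: nat. \<Union>m :: int. {b - real n * \<alpha> + m, - b - real n * \<alpha> + m})"
  have "countable B" unfolding B_def by (intro countable_UN) auto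
  then obtain t where t: "t \<notin> B" using uncountable_UNIV_real by (metis UNIV_eq_I)
  have "isCont S ((S ^^ n) (i, to_circle t))" for i n
  proof -
    have "t + real n * \<alpha> - b \<notin> \<int>" "t + real n * \<alpha> + b \<notin> \<int>"
    proof -
      have "t \<in> B" if "t + real n * \<alpha> - b = of_int m \<or> t + real n * \<alpha> + b = of_int m" for m
        using that unfolding B_def by (auto intro!: exI[of _ n] exI[of _ m] simp: algebra_simps)
      then show "t + real n * \<alpha> - b \<notin> \<int>" "t + real n * \<alpha> + b \<notin> \<int>"
        using t by (metis Ints_cases)+
    qed
    then have "snd ((S ^^ n) (i, to_circle t)) \<notin> {to_circle b, to_circle (- b)}"
      by (simp add: snd_itm_funpow to_circle_eq_iff)
    then show ?thesis using isCont_itm by (metis prod.collapse)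
  qed
  then show thesis by (rule that)
qed

lemma omega_limit_subset_sections:
  assumes "x \<in> sections q"
  shows "omega_limit S x \<subseteq> sections q"
proof -
  have "closed (sections q)" unfolding sections_def by (intro closed_Times closed_UNIV finite_imp_closed) simp
  then have "closure {(S ^^ n) x | n. n \<ge> 0} \<subseteq> sections q"
    by (intro closure_minimal) (use itm_funpow_sections[OF assms] in auto)
  moreover have "omega_limit S x \<subseteq> closure {(S ^^ n) x | n. n \<ge> 0}"
    unfolding omega_limit_def by (rule INT_lower) simp
  ultimately show ?thesis by (rule subset_trans[rotated])
qed

lemma omega_limit_meets_fibre:
  assumes x: "x \<in> sections q"
  obtains i where "i < q" "(i, y) \<in> omega_limit S x"
proof (rule ccontr)
  note hit = that
  assume "\<not> thesis"
  then have out: "(i, y) \<notin> omega_limit S x" if "i < q" for i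
    using hit that by blast
  have "\<exists>N e. e > 0 \<and> (\<forall>n\<ge>N. fst ((S ^^ n) x) = i \<longrightarrow> \<not> dist (snd ((S ^^ n) x)) y < e)" if i: "i < q" for i
  proof -
    obtain N where "(i, y) \<in> - closure {(S ^^ n) x | n. n \<ge> N}"
      using out[OF i] by (auto simp: omega_limit_def)
    then obtain V W where VW: "open W" "i \<in> V" "y \<in> W" "V \<times> W \<subseteq> - closure {(S ^^ n) x | n. n \<ge> N}"
      by (rule open_prod_elim[OF open_Compl[OF closed_closure]]) blast
    then obtain e where e: "e > 0" "\<And>w. dist w y < e \<Longrightarrow> w \<in> W" by (auto simp: open_dist)
    have "\<not> dist (snd ((S ^^ n) x)) y < e" if n: "n \<ge> N" "fst ((S ^^ n) x) = i" for n
    proof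
      assume "dist (snd ((S ^^ n) x)) y < e"
      then have "(S ^^ n) x \<in> V \<times> W" using e(2) VW(2) n(2) by (simp add: mem_Times_iff)
      then have "(S ^^ n) x \<in> - closure {(S ^^ n) x | n. n \<ge> N}" by (rule subsetD[OF VW(4)])
      then have "(S ^^ n) x \<notin> closure {(S ^^ n) x | n. n \<ge> N}" by (rule ComplD)
      moreover have "(S ^^ n) x \<in> {(S ^^ n) x | n. n \<ge> N}" using n(1) by blast
      then have "(S ^^ n) x \<in> closure {(S ^^ n) x | n. n \<ge> N}" by (rule closure_subset[THEN subsetD])
      ultimately show False by (rule notE)
    qed
    then show ?thesis using e(1) by blast
  qed
  then obtain N e where Ne: "\<And>i. i < q \<Longrightarrow> e i > 0"
    "\<And>i n. i < q \<Longrightarrow> n \<ge> N i \<Longrightarrow> fst ((S ^^ n) x) = i \<Longrightarrow> \<not> dist (snd ((S ^^ n) x)) y < e i"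
    by metis
  define K where "K = Max (N ` {..<q})"
  define d where "d = Min (e ` {..<q})"
  have fin: "finite (N ` {..<q})" "finite (e ` {..<q})" "e ` {..<q} \<noteq> {}" using p by auto
  have "d > 0" unfolding d_def using Ne(1) fin by (subst Min_gr_iff) auto
  obtain m :: nat where m: "dist y (rotate (real m * \<alpha>) (snd ((S ^^ K) x))) < d"
    using rotation_orbit_dense[OF irrational \<open>d > 0\<close>] by blast
  define z where "z = (S ^^ (m + K)) x"
  have z: "snd z = rotate (real m * \<alpha>) (snd ((S ^^ K) x))" "fst z < q"
    using itm_funpow_sections[OF x, of "m + K"]
    by (auto simp: z_def snd_itm_funpow sections_def mem_Times_iff algebra_simps add_divide_distrib)
  have "dist (snd z) y < d"
    using m z(1) by (simp add: dist_commute)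
  also have "d \<le> e (fst z)" unfolding d_def using fin z(2) by (intro Min_le) auto
  finally have "dist (snd z) y < e (fst z)" .
  moreover have "N (fst z) \<le> m + K"
    unfolding K_def using fin z(2) by (intro trans_le_add2 Max_ge) auto
  then have "\<not> dist (snd z) y < e (fst z)"
    by (rule Ne(2)[OF z(2), of "m + K", folded z_def]) (rule refl)
  ultimately show False by contradiction
qed

lemma card_minimal_components:
  "finite {C. minimal_component (sections q) S C}"
  "card {C. minimal_component (sections q) S C} \<le> q"
proof -
  let ?MC = "{C. minimal_component (sections q) S C}"
  obtain y where y: "\<And>i n. isCont S ((S ^^ n) (i, y))" by (rule regular_fibre) blast
  have "\<forall>C\<in>?MC. \<exists>i. i < q \<and> (i, y) \<in> C"
    by (auto simp: minimal_component_def) (metis omega_limit_meets_fibre)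
  then obtain ind where ind: "\<And>C. C \<in> ?MC \<Longrightarrow> ind C < q \<and> (ind C, y) \<in> C"
    unfolding bchoice_iff by blast
  have inj: "inj_on ind ?MC"
  proof (rule inj_onI)
    fix C D assume CD: "C \<in> ?MC" "D \<in> ?MC" "ind C = ind D"
    then have "(ind C, y) \<in> C" "(ind C, y) \<in> D" using ind by metis+
    then show "C = D" using CD minimal_component_eq_of_common_point[of "sections q" S C D "(ind C, y)"] y by blast
  qed
  have sub: "ind ` ?MC \<subseteq> {..<q}" using ind by auto
  show "finite ?MC" using inj_on_finite[OF inj sub] by simp
  show "card ?MC \<le> q" using card_inj_on_le[OF inj sub] by simp
qed

section \<open>Ergodic measures\<close>

lemma projection_invariant:
  assumes "invariant_measure_on S C M"
  shows "prob_space (distr M borel snd)" "distr (distr M borel snd) borel (rotate \<alpha>) = distr M borel snd"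
    "snd \<in> M \<rightarrow>\<^sub>M (borel :: circle measure)"
proof -
  have M: "prob_space M" "sets M = sets borel" "\<And>A. A \<in> sets borel \<Longrightarrow> emeasure M (S -` A) = emeasure M A"
    using assms by (auto simp: invariant_measure_on_def)
  interpret prob_space M by fact
  have sp: "space M = UNIV" using sets_eq_imp_space_eq[OF M(2)] by simp
  have "snd \<in> borel \<rightarrow>\<^sub>M (borel :: circle measure)"
    by (intro borel_measurable_continuous_onI continuous_on_snd continuous_on_id)
  then show snd: "snd \<in> M \<rightarrow>\<^sub>M (borel :: circle measure)" using M(2) by (simp cong: measurable_cong_sets)
  show "prob_space (distr M borel snd)" using snd by (rule prob_space_distr)
  have rot: "rotate \<alpha> \<in> borel \<rightarrow>\<^sub>M borel"
    by (intro borel_measurable_continuous_onI continuous_on_rotate continuous_on_id)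
  show "distr (distr M borel snd) borel (rotate \<alpha>) = distr M borel snd"
  proof (rule measure_eqI)
    fix A assume "A \<in> sets (distr (distr M borel snd) borel (rotate \<alpha>))"
    then have A: "A \<in> sets borel" by simp
    have sA: "(snd :: nat \<times> circle \<Rightarrow> circle) -` A \<in> sets borel" using measurable_sets[OF snd A] sp M(2) by simp
    have "rotate \<alpha> -` A \<in> sets borel" using measurable_sets[OF rot A] by simp
    then have "emeasure (distr (distr M borel snd) borel (rotate \<alpha>)) A = emeasure M (snd -` rotate \<alpha> -` A)"
      using A rot snd sp by (simp add: emeasure_distr)
    also have "snd -` rotate \<alpha> -` A = S -` snd -` A" by (simp add: set_eq_iff snd_itm)
    also have "emeasure M (S -` snd -` A) = emeasure M (snd -` A)" using M(3) sA by blast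
    finally show "emeasure (distr (distr M borel snd) borel (rotate \<alpha>)) A = emeasure (distr M borel snd) A"
      using A snd sp by (simp add: emeasure_distr)
  qed simp
qed

lemma projection_unique:
  assumes "invariant_measure_on S C M" "invariant_measure_on S C N"
  shows "distr M borel snd = distr N borel snd"
  using rotation_uniquely_ergodic[OF irrational] projection_invariant[OF assms(1)] projection_invariant[OF assms(2)]
  by (metis sets_distr)

lemma card_ergodic_measures_le:
  assumes C: "C \<subseteq> sections q" and F: "finite F" "\<And>M. M \<in> F \<Longrightarrow> ergodic_measure_on S C M"
  shows "card F \<le> q"
proof (cases "F = {}")
  case False
  then obtain M0 where M0: "M0 \<in> F" by blast
  have inv: "invariant_measure_on S C M" if "M \<in> F" for M
    using F(2)[OF that] by (simp add: ergodic_measure_on_def)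
  have M: "prob_space M" "sets M = sets borel" "emeasure M C = 1" "space M = UNIV" if "M \<in> F" for M
    using inv[OF that] sets_eq_imp_space_eq[of M borel] by (auto simp: invariant_measure_on_def)
  have "\<exists>A. A \<in> sets borel \<and> emeasure M A = 1 \<and> emeasure N A = 0" if "M \<in> F" "N \<in> F" "M \<noteq> N" for M N
    using ergodic_measures_separated[OF measurable_itm F(2)[OF that(1)] F(2)[OF that(2)] that(3)] by metis
  then obtain A where A: "\<And>M N. M \<in> F \<Longrightarrow> N \<in> F \<Longrightarrow> M \<noteq> N \<Longrightarrow>
      A M N \<in> sets borel \<and> emeasure M (A M N) = 1 \<and> emeasure N (A M N) = 0"
    by metis
  define B where "B = (\<lambda>M. sections q \<inter> (\<Inter>N\<in>F - {M}. A M N - A N M))"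
  have B_sets: "B M \<in> sets borel" and B_ae: "AE z in M. z \<in> B M" if "M \<in> F" for M
  proof -
    interpret prob_space M using M that by blast
    have sec: "sections q \<in> sets borel"
      unfolding sections_def by (intro borel_closed closed_Times closed_UNIV finite_imp_closed) simp
    have AMN: "A M N \<in> sets borel" "A N M \<in> sets borel" if "N \<in> F - {M}" for N
      using A \<open>M \<in> F\<close> that by auto
    have "(\<Inter>N\<in>F - {M}. A M N - A N M) \<in> sets borel" if "F - {M} \<noteq> {}"
      using AMN F(1) that by (intro sets.finite_INT) auto
    then show "B M \<in> sets borel"
      using sec unfolding B_def by (cases "F - {M} = {}") (simp_all only: INT_empty Int_UNIV_right sets.Int simp_thms)
    have "C \<in> sets M" using M(3)[OF that] emeasure_notin_sets by fastforce
    then have "AE z in M. z \<in> C" using M(3)[OF that] AE_in_set_eq_1[of C] by (simp add: emeasure_eq_measure)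
    moreover have "AE z in M. \<forall>N\<in>F - {M}. z \<in> A M N - A N M"
    proof (rule AE_finite_allI)
      fix N assume N: "N \<in> F - {M}"
      then have "emeasure M (A M N) = 1" "emeasure M (A N M) = 0" using A that by auto
      moreover have "A M N \<in> events" "A N M \<in> events" using AMN[OF N] M(2)[OF that] by auto
      ultimately have "AE z in M. z \<in> A M N" "AE z in M. z \<notin> A N M"
        using AE_in_set_eq_1[of "A M N"] by (auto simp: emeasure_eq_measure AE_iff_null null_sets_def Collect_mem_eq M(4)[OF that])
      then show "AE z in M. z \<in> A M N - A N M" by eventually_elim auto
    qed (use F(1) in simp)
    ultimately show "AE z in M. z \<in> B M"
      by eventually_elim (use C in \<open>auto simp: B_def\<close>)
  qed
  define U where "U = (\<lambda>M. \<Union>i<q. Pair i -` B M)"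
  define \<nu> where "\<nu> = distr M0 borel (snd :: nat \<times> circle \<Rightarrow> circle)"
  have U_ae: "AE y in \<nu>. y \<in> U M" if "M \<in> F" for M
  proof -
    have "Pair i -` B M \<in> sets (borel :: circle measure)" for i
      using measurable_sets[OF borel_measurable_continuous_onI[of "Pair i"] B_sets[OF that]]
      by (simp add: continuous_on_Pair)
    then have U_sets: "U M \<in> sets borel" unfolding U_def by auto
    have "AE z in M. snd z \<in> U M"
      using B_ae[OF that] by eventually_elim (force simp: U_def B_def sections_def)
    then have "AE y in distr M borel snd. y \<in> U M"
      using projection_invariant(3)[OF inv[OF that]] U_sets by (subst AE_distr_iff) auto
    then show ?thesis by (simp only: \<nu>_def projection_unique[OF inv[OF M0] inv[OF that]])
  qed
  then have "AE y in \<nu>. \<forall>M\<in>F. y \<in> U M" using F(1) by (intro AE_finite_allI) auto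
  moreover have "prob_space \<nu>" unfolding \<nu>_def by (rule projection_invariant(1)[OF inv[OF M0]])
  ultimately obtain y where "\<forall>M\<in>F. y \<in> U M"
    using prob_space.ae_filter_bot eventually_happens' by blast
  then have "\<forall>M\<in>F. \<exists>i. i < q \<and> (i, y) \<in> B M" by (auto simp: U_def)
  then obtain ind where ind: "\<And>M. M \<in> F \<Longrightarrow> ind M < q \<and> (ind M, y) \<in> B M"
    unfolding bchoice_iff by blast
  have "inj_on ind F"
  proof (rule inj_onI, rule ccontr)
    fix M N assume MN: "M \<in> F" "N \<in> F" "ind M = ind N" "M \<noteq> N"
    then have "(ind M, y) \<in> B M" "(ind M, y) \<in> B N" using ind by metis+
    then show False using MN by (auto simp: B_def)
  qed
  then show ?thesis using card_inj_on_le[of ind F "{..<q}"] ind by auto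
qed simp

lemma card_ergodic_measures:
  assumes "C \<subseteq> sections q"
  shows "finite {M. ergodic_measure_on S C M}" "card {M. ergodic_measure_on S C M} \<le> q"
proof -
  show fin: "finite {M. ergodic_measure_on S C M}"
  proof (rule ccontr)
    assume "infinite {M. ergodic_measure_on S C M}"
    then obtain F where "F \<subseteq> {M. ergodic_measure_on S C M}" "finite F" "card F = Suc q"
      using infinite_arbitrarily_large by blast
    then show False using card_ergodic_measures_le[OF assms, of F] by auto
  qed
  show "card {M. ergodic_measure_on S C M} \<le> q"
    using card_ergodic_measures_le[OF assms fin] by simp
qed

end

theorem corollary10:
  fixes p q :: nat and b \<theta> :: real
  assumes "p > 0" and "q > 0"
    and "real p / real q < 1/2"
    and "0 < b" and "b < 1/2"
    and "\<not> exceptional (real p / real q) b \<theta>"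
  shows "finite {C. minimal_component (sections q) (itm p q b \<theta>) C}
       \<and> card {C. minimal_component (sections q) (itm p q b \<theta>) C} \<le> q
       \<and> (\<forall>C. minimal_component (sections q) (itm p q b \<theta>) C \<longrightarrow>
            finite {M. ergodic_measure_on (itm p q b \<theta>) C M}
          \<and> card {M. ergodic_measure_on (itm p q b \<theta>) C M} \<le> 1 + 2 * q)"
proof -
  have "tan \<theta> \<notin> \<rat>"
    using nonexceptional_irrational[of "real p / real q" b \<theta>] assms by auto
  then have "tan \<theta> / real q \<notin> \<rat>"
    using assms(2) by (metis Rats_mult Rats_of_nat nonzero_eq_divide_eq of_nat_0_less_iff order_less_irrefl)
  moreover have "p < q" using assms(2,3) by (simp add: field_simps)
  ultimately interpret irrational_itm p q b \<theta>
    by unfold_locales (use assms in auto)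
  have "finite {M. ergodic_measure_on (itm p q b \<theta>) C M}
      \<and> card {M. ergodic_measure_on (itm p q b \<theta>) C M} \<le> 1 + 2 * q"
    if "minimal_component (sections q) (itm p q b \<theta>) C" for C
  proof -
    have "C \<subseteq> sections q"
      using that omega_limit_subset_sections by (auto simp: minimal_component_def)
    then show ?thesis using card_ergodic_measures[of C] by auto
  qed
  then show ?thesis using card_minimal_components by blast
qed

end
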